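(* Let $m\ge 1$ be an integer, $n\ge 2$ an even integer, $1\le k\le n$ an integer, $U$ an $m\times m$ unitary matrix and $W=UU^{T}$. For $x=(x_1,\dots,x_n)\in[m]^n$ let $q_n(x)=\frac{1}{f_n}|\mathrm{Haf}(W_x)|^2$, where $f_n=n!\binom{\frac{m+n}{2}-1}{\frac n2}$, and let $q_n(x_1,\dots,x_k)=\sum_{x_{k+1},\dots,x_n\in[m]}q_n(x_1,\dots,x_n)$ be the marginal. Then for all $(x_1,\dots,x_k)\in[m]^k$, $$q_n(x_1,\dots,x_k)=\sum_{j_1,j_2}\ \sum_{a,a'}\mathrm{Haf}(R_a)\,\mathrm{Haf}(R^*_{a'})\sum_{\mu\in S_\mu}F^{(\mu)}_{j_1,j_2}\sum_{A,B}\mathrm{Per}(S_{A,B})\,\mathrm{Haf}(R_e)\,\mathrm{Haf}(R^*_{e'}),$$ where $$F^{(\mu)}_{j_1,j_2}=\frac{(n-k)!}{f_n}\binom{\frac{n-k+\mu+m}{2}-1}{k-j_1-j_2+\frac m2-1},$$ and the summation ranges are: 1. $j_1,j_2$ each range over the integers from $\max(0,k-\frac n2)$ to $\frac k2$ (inclusive); 2. $a$ ranges over the $2j_1$-element subsets of $[k]$ and $a'$ over the $2j_2$-element subsets of $[k]$; 3. $S_\mu=\{\mu\in\mathbb{N}:\ 3k-2(j_1+j_2)-n\le\mu\le k-2\max(j_1,j_2),\ \mu\equiv k \bmod 2\}$; 4. $A$ ranges over the $\mu$-element subsets of $[k]\setminus a$ and $B$ over the $\mu$-element subsets of $[k]\setminus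 a'$; 5. $e=[k]\setminus(a\cup A)$ and $e'=[k]\setminus(a'\cup B)$.
   Context: Notation: $[m]=\{1,\dots,m\}$; $\mathbb{N}$ includes $0$. For a symmetric $N\times N$ complex matrix $V$ with $N$ even, the Hafnian is $\mathrm{Haf}(V)=\sum_{\sigma}\prod_{\{i,j\}\in\sigma}V(i,j)$, the sum being over all perfect matchings $\sigma$ of $[N]$ (partitions of $[N]$ into $N/2$ unordered pairs). $\mathrm{Per}$ is the permanent. The Hafnian and the permanent of the empty ($0\times0$) matrix equal $1$. For $x\in[m]^n$, $W_x$ is the $n\times n$ matrix with entries $W_x(i,j)=W(x_i,x_j)$. Given $(x_1,\dots,x_k)$ and a subset $a\subseteq[k]$ of positions (listed in increasing order), $R_a$ is the $|a|\times|a|$ matrix $(W(x_i,x_j))_{i,j\in a}$ and $R^*_a$ is its entrywise complex conjugate $(\overline{W(x_i,x_j)})_{i,j\in a}$. For $A=\{A_1<\dots<A_\mu\}$ and $B=\{B_1<\dots<B_\mu\}$ subsets of $[k]$, $S_{A,B}$ is the $\mu\times\mu$ zero-one matrix with $S_{A,B}(i,j)=1$ if $x_{A_i}=x_{B_j}$ and $0$ otherwise. Binomial convention: for real $N$ and integer $d\ge0$, $\binom{N}{d}=N(N-1)\cdots(N-d+1)/d!$; and when $N-d$ (possibly a half-integer) appears as the lower index, with $d\geq 0$ an integer, $\binom{N}{N-d}$ means $\binom{N}{d}$. In the formula for $F^{(\mu)}_{j_1,j_2}$ the difference of upper and lower index is the non-negative integer $d=\frac{n-3k+\mu+2j_1+2j_2}{2}$.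 *)

theory Defs
  imports
    Complex_Main
    "HOL-Library.Disjoint_Sets"
    "Jordan_Normal_Form.Schur_Decomposition"
    "Jordan_Normal_Form.DL_Submatrix"
begin

text \<open>
  Matrices, tuples and positions are indexed from 0, so \<open>[m]\<close> is rendered as \<open>{..<m}\<close>.
  A tuple over \<open>[m]\<close> is a list whose entries lie in \<open>{..<m}\<close>.
\<close>

definition unitary_mat :: "nat \<Rightarrow> complex mat \<Rightarrow> bool" where
  "unitary_mat m U \<longleftrightarrow>
     U \<in> carrier_mat m m \<and> mat_adjoint U * U = 1\<^sub>m m \<and> U * mat_adjoint U = 1\<^sub>m m"

definition perfect_matchings :: "nat set \<Rightarrow> nat set set set" where
  "perfect_matchings I = {\<sigma>. partition_on I \<sigma> \<and> (\<forall>p\<in>\<sigma>. card p = 2)}"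

text \<open>
  The entry at an unordered pair \<open>{i, j}\<close> is read off above the diagonal; the Hafnian is only
  meant for symmetric matrices, where this choice is immaterial.
\<close>

definition hafnian :: "complex mat \<Rightarrow> complex" where
  "hafnian V = (\<Sum>\<sigma>\<in>perfect_matchings {..<dim_row V}. \<Prod>p\<in>\<sigma>. V $$ (Min p, Max p))"

definition permanent :: "complex mat \<Rightarrow> complex" where
  "permanent M = (\<Sum>\<pi> | \<pi> permutes {..<dim_row M}. \<Prod>i<dim_row M. M $$ (i, \<pi> i))"

text \<open>
  The binomial coefficient of real \<open>N\<close> over real \<open>L\<close>, for \<open>N - L\<close> a non-negative integer (\<open>L\<close>
  itself may be a half-integer): with \<open>d = N - L\<close> it stands for \<open>N (N - 1) \<dots> (N - d + 1) / d!\<close>.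
  If \<open>N - L\<close> is not a non-negative integer, the value is meaningless.
\<close>

definition binom_codeg :: "real \<Rightarrow> real \<Rightarrow> real" where
  "binom_codeg N L = N gchoose nat \<lfloor>N - L\<rfloor>"

definition tuples :: "nat \<Rightarrow> nat \<Rightarrow> nat list set" where
  "tuples m n = {xs. length xs = n \<and> set xs \<subseteq> {..<m}}"

definition tuple_mat :: "complex mat \<Rightarrow> nat list \<Rightarrow> complex mat" where
  "tuple_mat W xs = mat (length xs) (length xs) (\<lambda>(i, j). W $$ (xs ! i, xs ! j))"

definition norm_f :: "nat \<Rightarrow> nat \<Rightarrow> real" where
  "norm_f m n = fact n * (((real m + real n) / 2 - 1) gchoose (n div 2))"

definition q_prob :: "nat \<Rightarrow> complex mat \<Rightarrow> nat \<Rightarrow> nat list \<Rightarrow> real" where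
  "q_prob m W n xs = 1 / norm_f m n * (cmod (hafnian (tuple_mat W xs)))\<^sup>2"

definition q_marginal :: "nat \<Rightarrow> complex mat \<Rightarrow> nat \<Rightarrow> nat \<Rightarrow> nat list \<Rightarrow> real" where
  "q_marginal m W n k xs = (\<Sum>ys\<in>tuples m (n - k). q_prob m W n (xs @ ys))"

definition R_mat :: "complex mat \<Rightarrow> nat list \<Rightarrow> nat set \<Rightarrow> complex mat" where
  "R_mat W xs a = submatrix (tuple_mat W xs) a a"

definition R_conj_mat :: "complex mat \<Rightarrow> nat list \<Rightarrow> nat set \<Rightarrow> complex mat" where
  "R_conj_mat W xs a = map_mat cnj (R_mat W xs a)"

definition S_mat :: "nat list \<Rightarrow> nat set \<Rightarrow> nat set \<Rightarrow> complex mat" where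
  "S_mat xs A B =
     submatrix (mat (length xs) (length xs) (\<lambda>(i, j). if xs ! i = xs ! j then 1 else 0)) A B"

definition F_coeff :: "nat \<Rightarrow> nat \<Rightarrow> nat \<Rightarrow> nat \<Rightarrow> nat \<Rightarrow> nat \<Rightarrow> real" where
  "F_coeff m n k \<mu> j1 j2 =
     fact (n - k) / norm_f m n *
     binom_codeg ((real n - real k + real \<mu> + real m) / 2 - 1)
                 (real k - real j1 - real j2 + real m / 2 - 1)"

definition j_range :: "nat \<Rightarrow> nat \<Rightarrow> nat set" where
  "j_range n k = {j. max 0 (real k - real n / 2) \<le> real j \<and> real j \<le> real k / 2}"

definition mu_range :: "nat \<Rightarrow> nat \<Rightarrow> nat \<Rightarrow> nat \<Rightarrow> nat set" where
  "mu_range n k j1 j2 =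
     {\<mu>. 3 * int k - 2 * (int j1 + int j2) - int n \<le> int \<mu> \<and>
         int \<mu> \<le> int k - 2 * max (int j1) (int j2) \<and> \<mu> mod 2 = k mod 2}"

definition subsets_of_card :: "nat set \<Rightarrow> nat \<Rightarrow> nat set set" where
  "subsets_of_card X r = {a. a \<subseteq> X \<and> card a = r}"

end

theory Submission
  imports Defs
begin

text \<open>
  Expand the sum over \<open>y\<close> of \<open>\<bar>Haf(W\<^sub>x\<^sub>y)\<bar>\<^sup>2\<close> one coordinate at a time. The sums that occur are
  \<open>\<Sum>\<^sub>A\<^sub>,\<^sub>B c(|A|) Per(S\<^sub>A\<^sub>,\<^sub>B) Haf(R\<^sub>P\<^sub>-\<^sub>A) Haf(R\<^sup>*\<^sub>P\<^sub>-\<^sub>B)\<close> with a weight \<open>c\<close>. Expanding along a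
  new position and summing over its value, using that \<open>W\<close> is symmetric and unitary, gives a sum of
  the same shape with the weight \<open>\<mu> c(\<mu> - 1) + (m + 2 k - \<mu>) c(\<mu> + 1)\<close>. Starting from the weight
  supported at 0, this recursion is solved by \<open>l! binom(k + (m + l - \<mu>) / 2 - 1, (l - \<mu>) / 2)\<close>
  after \<open>l = n - k\<close> steps. On the right-hand side the products \<open>Haf(R\<^sub>a) Haf(R\<^sub>e)\<close> with \<open>a \<union> e\<close>
  fixed add up to binomial multiples of one Hafnian, and Vandermonde's identity, used for \<open>a\<close> and
  for \<open>a'\<close>, turns the coefficients \<open>F\<close> into the same weight.
\<close>

section \<open>Expansion of Hafnians and permanents over index sets\<close>

text \<open>Indexed by an arbitrary set of positions instead of by a matrix, so that positions can
  be deleted without renumbering. As in \<open>hafnian\<close>, a pair is read in increasing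
  order.\<close>

definition haf :: "(nat \<Rightarrow> nat \<Rightarrow> 'a::comm_ring_1) \<Rightarrow> nat set \<Rightarrow> 'a" where
  "haf w I = (\<Sum>\<sigma>\<in>perfect_matchings I. \<Prod>p\<in>\<sigma>. w (Min p) (Max p))"

text \<open>\<open>A\<close> holds the row positions and \<open>B\<close> the column positions. The
  functions are extensional, so that each bijection from \<open>A\<close> onto \<open>B\<close> is
  counted exactly once.\<close>

definition per :: "(nat \<Rightarrow> nat \<Rightarrow> 'a::comm_ring_1) \<Rightarrow> nat set \<Rightarrow> nat set \<Rightarrow> 'a" where
  "per d A B = (\<Sum>f | f \<in> A \<rightarrow>\<^sub>E B \<and> bij_betw f A B. \<Prod>i\<in>A. d i (f i))"

lemma perfect_matchings_empty: "perfect_matchings {} = {{}}"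
  by (auto simp: perfect_matchings_def partition_on_def)

lemma haf_empty [simp]: "haf w {} = 1"
  by (simp add: haf_def perfect_matchings_empty)

lemma finite_perfect_matchings:
  assumes "finite I" shows "finite (perfect_matchings I)"
proof (rule finite_subset)
  show "perfect_matchings I \<subseteq> Pow (Pow I)"
    by (auto simp: perfect_matchings_def partition_on_def)
qed (use assms in auto)

text \<open>Sort the matchings by the partner \<open>j\<close> of \<open>i\<close>: removing the
  pair \<open>{i, j}\<close> leaves a perfect matching of the other points.\<close>

lemma perfect_matchings_insert:
  assumes "i \<notin> I"
  shows "perfect_matchings (insert i I) = (\<Union>j\<in>I. insert {i, j} ` perfect_matchings (I - {j}))"
proof (intro equalityI subsetI)
  fix \<sigma> assume "\<sigma> \<in> perfect_matchings (insert i I)"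
  then have part: "partition_on (insert i I) \<sigma>" and two: "\<And>p. p \<in> \<sigma> \<Longrightarrow> card p = 2"
    by (auto simp: perfect_matchings_def)
  obtain p where p: "p \<in> \<sigma>" "i \<in> p"
    using part by (auto simp: partition_on_def)
  obtain j where j: "p = {i, j}" "j \<noteq> i"
    using two[OF p(1)] p(2) by (auto simp: card_2_iff)
  have jI: "j \<in> I"
    using part p j by (auto simp: partition_on_def)
  define \<tau> where "\<tau> = \<sigma> - {p}"
  have \<sigma>: "\<sigma> = insert p \<tau>" using p by (auto simp: \<tau>_def)
  have disj: "disjnt p (\<Union>\<tau>)"
    using part p unfolding \<tau>_def partition_on_def disjoint_def disjnt_def by blast
  have "partition_on (insert i I - p) \<tau>"
    using part partition_on_insert[OF disj] by (simp add: \<sigma>)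
  moreover have "insert i I - p = I - {j}" using j assms by auto
  ultimately have "\<tau> \<in> perfect_matchings (I - {j})"
    using two by (auto simp: perfect_matchings_def \<tau>_def)
  then show "\<sigma> \<in> (\<Union>j\<in>I. insert {i, j} ` perfect_matchings (I - {j}))"
    using jI \<sigma> j by auto
next
  fix \<sigma> assume "\<sigma> \<in> (\<Union>j\<in>I. insert {i, j} ` perfect_matchings (I - {j}))"
  then obtain j \<tau> where j: "j \<in> I" and \<sigma>: "\<sigma> = insert {i, j} \<tau>"
    and \<tau>: "partition_on (I - {j}) \<tau>" "\<forall>p\<in>\<tau>. card p = 2"
    by (auto simp: perfect_matchings_def)
  have ij: "i \<noteq> j" using j assms by auto
  have disj: "disjnt {i, j} (\<Union>\<tau>)"
    using \<tau> j assms by (auto simp: partition_on_def disjnt_def)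
  have "insert i I - {i, j} = I - {j}" using assms by auto
  then show "\<sigma> \<in> perfect_matchings (insert i I)"
    using \<tau> j ij partition_on_insert[OF disj] by (auto simp: perfect_matchings_def \<sigma>)
qed

text \<open>The analogue of expanding a determinant along a row, with \<open>j\<close> the partner
  of \<open>i\<close>. Symmetry allows the factor to be written \<open>w i j\<close> whichever of
  the two indices is larger.\<close>

lemma haf_insert:
  assumes fin: "finite I" and i: "i \<notin> I" and sym: "\<And>a b. w a b = w b a"
  shows "haf w (insert i I) = (\<Sum>j\<in>I. w i j * haf w (I - {j}))"
proof -
  \<comment> \<open>Matchings of \<open>I - {j'}\<close> do not cover \<open>i\<close>, so a pair
    containing \<open>i\<close> is new to them. This makes the insertion injective and keeps the
    families of different partners apart.\<close>
  have nin: "{i, j} \<notin> \<sigma>" if "\<sigma> \<in> perfect_matchings (I - {j'})" for \<sigma> j j'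
    using that i by (auto simp: perfect_matchings_def partition_on_def)
  have inj: "inj_on (insert {i, j}) (perfect_matchings (I - {j}))" for j
    using nin by (intro inj_onI) (metis insert_ident)
  have fin\<sigma>: "finite \<sigma>" if "\<sigma> \<in> perfect_matchings (I - {j})" for \<sigma> j
    using that fin by (auto simp: perfect_matchings_def intro: finite_elements)
  have disj: "insert {i, j} ` perfect_matchings (I - {j}) \<inter>
      insert {i, j'} ` perfect_matchings (I - {j'}) = {}" if "j \<in> I" "j' \<in> I" "j \<noteq> j'" for j j'
  proof -
    have "{i, j} \<noteq> {i, j'}" using that i by (auto simp: doubleton_eq_iff)
    then have "{i, j} \<notin> insert {i, j'} \<sigma>" if "\<sigma> \<in> perfect_matchings (I - {j'})" for \<sigma>
      using nin[OF that] by simp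
    then show ?thesis by (metis (no_types, lifting) disjoint_iff imageE insertI1)
  qed
  have wij: "w (Min {i, j}) (Max {i, j}) = w i j" for j
    by (cases "i \<le> j") (simp_all add: min_def max_def sym[of j i])
  have "haf w (insert i I) = (\<Sum>j\<in>I. \<Sum>\<sigma>\<in>insert {i, j} ` perfect_matchings (I - {j}).
      \<Prod>p\<in>\<sigma>. w (Min p) (Max p))"
    unfolding haf_def perfect_matchings_insert[OF i]
    by (rule sum.UNION_disjoint) (use fin disj in \<open>auto intro: finite_perfect_matchings\<close>)
  also have "\<dots> = (\<Sum>j\<in>I. w i j * haf w (I - {j}))"
  proof (intro sum.cong refl)
    fix j assume j: "j \<in> I"
    have "(\<Sum>\<sigma>\<in>insert {i, j} ` perfect_matchings (I - {j}). \<Prod>p\<in>\<sigma>. w (Min p) (Max p)) =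
      (\<Sum>\<sigma>\<in>perfect_matchings (I - {j}). \<Prod>p\<in>insert {i, j} \<sigma>. w (Min p) (Max p))"
      by (simp add: sum.reindex[OF inj])
    also have "\<dots> = (\<Sum>\<sigma>\<in>perfect_matchings (I - {j}). w i j * (\<Prod>p\<in>\<sigma>. w (Min p) (Max p)))"
      by (rule sum.cong[OF refl], subst prod.insert) (use fin\<sigma> nin wij in auto)
    finally show "(\<Sum>\<sigma>\<in>insert {i, j} ` perfect_matchings (I - {j}). \<Prod>p\<in>\<sigma>. w (Min p) (Max p)) =
      w i j * haf w (I - {j})"
      by (simp add: haf_def sum_distrib_left)
  qed
  finally show ?thesis .
qed

lemma haf_remove:
  assumes "finite I" "i \<in> I" "\<And>a b. w a b = w b a"
  shows "haf w I = (\<Sum>j\<in>I - {i}. w i j * haf w (I - {i} - {j}))"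
  using haf_insert[of "I - {i}" i w] assms by (simp add: insert_absorb)

lemma haf_cong:
  assumes "finite I" and "\<And>i j. i \<in> I \<Longrightarrow> j \<in> I \<Longrightarrow> w i j = w' i j"
  shows "haf w I = haf w' I"
  unfolding haf_def
proof (intro sum.cong prod.cong refl)
  fix \<sigma> p assume "\<sigma> \<in> perfect_matchings I" "p \<in> \<sigma>"
  then have p: "p \<subseteq> I" "card p = 2" by (auto simp: perfect_matchings_def partition_on_def)
  then have "finite p" "p \<noteq> {}" using assms(1) finite_subset by auto
  then have "Min p \<in> I" "Max p \<in> I" using p Min_in Max_in by blast+
  then show "w (Min p) (Max p) = w' (Min p) (Max p)" using assms(2) by blast
qed

text \<open>Disjoint two-element blocks cover an even number of points, so the sum over matchings is
  empty.\<close>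

lemma haf_odd:
  assumes "finite I" "odd (card I)"
  shows "haf w I = 0"
proof -
  have "even (card I)" if "\<sigma> \<in> perfect_matchings I" for \<sigma>
  proof -
    have part: "partition_on I \<sigma>" using that by (simp add: perfect_matchings_def)
    have "card (\<Union>\<sigma>) = (\<Sum>p\<in>\<sigma>. card p)"
      using part assms(1)
      by (intro card_Union_disjoint)
        (auto simp: partition_on_def disjoint_def pairwise_def disjnt_def intro: finite_subset)
    then have "card I = (\<Sum>p\<in>\<sigma>. card p)"
      using part by (simp add: partition_on_def)
    also have "\<dots> = 2 * card \<sigma>" using that by (simp add: perfect_matchings_def)
    finally show ?thesis by simp
  qed
  then have "perfect_matchings I = {}" using assms(2) by blast
  then show ?thesis by (simp add: haf_def)
qed

text \<open>An injection may reverse the order within a pair, so \<open>Min\<close> and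
  \<open>Max\<close> are not transported along \<open>g\<close>. Expanding both sides along one
  index avoids this, since the expansion has already used symmetry.\<close>

lemma haf_image:
  assumes "finite I" "inj_on g I" and sym: "\<And>a b. w a b = w b a"
  shows "haf w (g ` I) = haf (\<lambda>i j. w (g i) (g j)) I"
  using assms(1,2)
proof (induction "card I" arbitrary: I rule: less_induct)
  case less
  show ?case
  proof (cases "I = {}")
    case False
    then obtain i where i: "i \<in> I" by auto
    have img: "g ` I - {g i} - {g j} = g ` (I - {i} - {j})" if "j \<in> I" for j
      using less.prems(2) i that by (auto simp: inj_on_def)
    have img1: "g ` I - {g i} = g ` (I - {i})"
      using less.prems(2) i by (auto simp: inj_on_def)
    have inj1: "inj_on g (I - {i})" using less.prems(2) by (rule inj_on_subset) auto
    have "haf w (g ` I) = (\<Sum>j\<in>g ` I - {g i}. w (g i) j * haf w (g ` I - {g i} - {j}))"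
      using less.prems i by (intro haf_remove sym) auto
    also have "\<dots> = (\<Sum>j\<in>I - {i}. w (g i) (g j) * haf w (g ` (I - {i} - {j})))"
      by (simp add: img1 sum.reindex[OF inj1] img[symmetric])
    also have "\<dots> = (\<Sum>j\<in>I - {i}. w (g i) (g j) * haf (\<lambda>i j. w (g i) (g j)) (I - {i} - {j}))"
    proof (rule sum.cong[OF refl])
      fix j assume "j \<in> I - {i}"
      have "card (I - {i} - {j}) < card I" using less.prems i
        by (intro psubset_card_mono) auto
      then show "w (g i) (g j) * haf w (g ` (I - {i} - {j})) =
          w (g i) (g j) * haf (\<lambda>i j. w (g i) (g j)) (I - {i} - {j})"
        using less.hyps[of "I - {i} - {j}"] less.prems inj_on_subset[of g I "I - {i} - {j}"]
        by (simp add: Diff_subset subset_insertI2 Diff_eq Int_assoc)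
    qed
    also have "\<dots> = haf (\<lambda>i j. w (g i) (g j)) I"
      using less.prems i sym by (intro haf_remove[symmetric]) auto
    finally show ?thesis .
  qed simp
qed

section \<open>Reindexing of sums over subsets\<close>

lemma sum_Pow_insert:
  assumes "finite P" "v \<notin> P"
  shows "(\<Sum>A\<in>Pow (insert v P). f A) = (\<Sum>A\<in>Pow P. f A) + (\<Sum>A\<in>Pow P. f (insert v A))"
proof -
  have "inj_on (insert v) (Pow P)" using assms(2) by (auto intro!: inj_onI)
  moreover have "Pow P \<inter> insert v ` Pow P = {}" using assms(2) by auto
  ultimately show ?thesis
    by (simp add: Pow_insert sum.union_disjoint assms(1) sum.reindex)
qed

lemma sum_Pow_notin:
  assumes "finite P"
  shows "(\<Sum>A\<in>Pow P. \<Sum>j\<in>P - A. f A j) = (\<Sum>j\<in>P. \<Sum>A\<in>Pow (P - {j}). f A j)"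
proof -
  have "(\<Sum>A\<in>Pow P. \<Sum>j\<in>P - A. f A j) = (\<Sum>A\<in>Pow P. \<Sum>j\<in>{j\<in>P. j \<notin> A}. f A j)"
    by (intro sum.cong) auto
  also have "\<dots> = (\<Sum>j\<in>P. \<Sum>A\<in>{A\<in>Pow P. j \<notin> A}. f A j)"
    using assms by (intro sum.swap_restrict) auto
  also have "\<dots> = (\<Sum>j\<in>P. \<Sum>A\<in>Pow (P - {j}). f A j)"
    by (intro sum.cong) auto
  finally show ?thesis .
qed

text \<open>The new summation variable is \<open>A\<close> without its marked element
  \<open>j\<close>.\<close>

lemma sum_Pow_in:
  assumes "finite P"
  shows "(\<Sum>A\<in>Pow P. \<Sum>j\<in>A. f A j) = (\<Sum>j\<in>P. \<Sum>A\<in>Pow (P - {j}). f (insert j A) j)"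
proof -
  have "(\<Sum>A\<in>Pow P. \<Sum>j\<in>A. f A j) = (\<Sum>A\<in>Pow P. \<Sum>j\<in>{j\<in>P. j \<in> A}. f A j)"
    by (intro sum.cong) auto
  also have "\<dots> = (\<Sum>j\<in>P. \<Sum>A\<in>{A\<in>Pow P. j \<in> A}. f A j)"
    using assms by (intro sum.swap_restrict) auto
  also have "\<dots> = (\<Sum>j\<in>P. \<Sum>A\<in>Pow (P - {j}). f (insert j A) j)"
  proof (rule sum.cong[OF refl])
    fix j assume "j \<in> P"
    then show "(\<Sum>A\<in>{A\<in>Pow P. j \<in> A}. f A j) = (\<Sum>A\<in>Pow (P - {j}). f (insert j A) j)"
      by (intro sum.reindex_bij_witness[of _ "insert j" "\<lambda>A. A - {j}"]) (auto simp: insert_absorb)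
  qed
  finally show ?thesis .
qed

text \<open>Both sides run over the ordered pairs of disjoint subsets of \<open>P\<close>.\<close>

lemma sum_Pow_disjoint_swap:
  assumes "finite P"
  shows "(\<Sum>a\<in>Pow P. \<Sum>A\<in>Pow (P - a). f a A) = (\<Sum>A\<in>Pow P. \<Sum>a\<in>Pow (P - A). f a A)"
proof -
  have "(\<Sum>a\<in>Pow P. \<Sum>A\<in>Pow (P - a). f a A) = (\<Sum>a\<in>Pow P. \<Sum>A\<in>{A\<in>Pow P. a \<inter> A = {}}. f a A)"
    by (intro sum.cong) auto
  also have "\<dots> = (\<Sum>A\<in>Pow P. \<Sum>a\<in>{a\<in>Pow P. a \<inter> A = {}}. f a A)"
    using assms by (intro sum.swap_restrict) auto
  also have "\<dots> = (\<Sum>A\<in>Pow P. \<Sum>a\<in>Pow (P - A). f a A)"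
    by (intro sum.cong) auto
  finally show ?thesis .
qed

section \<open>Permanents over pairs of index sets\<close>

lemma per_empty: "per d {} B = (if B = {} then 1 else 0)"
proof -
  have *: "{f. f \<in> {} \<rightarrow>\<^sub>E B \<and> bij_betw f {} B} = (if B = {} then {\<lambda>_. undefined} else {})"
    by (auto simp: bij_betw_def)
  show ?thesis unfolding per_def * by simp
qed

text \<open>Expansion along row \<open>i\<close>: the bijections are sorted by the image
  \<open>j\<close> of \<open>i\<close>.\<close>

lemma per_insert:
  assumes "finite A" "finite B" "i \<notin> A"
  shows "per d (insert i A) B = (\<Sum>j\<in>B. d i j * per d A (B - {j}))"
proof -
  have fin: "finite {f. f \<in> A \<rightarrow>\<^sub>E B' \<and> bij_betw f A B'}" if "finite B'" for B'
    using finite_PiE[of A "\<lambda>_. B'"] assms that by simp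
  have "per d (insert i A) B =
      (\<Sum>(j, f)\<in>Sigma B (\<lambda>j. {f. f \<in> A \<rightarrow>\<^sub>E (B - {j}) \<and> bij_betw f A (B - {j})}).
        d i j * (\<Prod>l\<in>A. d l (f l)))"
    unfolding per_def
  \<comment> \<open>Resetting the value at \<open>i\<close> to \<open>undefined\<close> keeps the
    restricted function extensional, so it is again one of the functions summed over.\<close>
  proof (rule sum.reindex_bij_witness[of _ "\<lambda>(j, f). f(i := j)" "\<lambda>f. (f i, f(i := undefined))"])
    fix f assume "f \<in> {f. f \<in> insert i A \<rightarrow>\<^sub>E B \<and> bij_betw f (insert i A) B}"
    then have f: "f \<in> insert i A \<rightarrow>\<^sub>E B" and b: "bij_betw f (insert i A) B" by auto
    have "bij_betw f A (B - {f i})"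
      using b assms(3) by (auto simp: bij_betw_def inj_on_def)
    then have b': "bij_betw (f(i := undefined)) A (B - {f i})"
      by (rule bij_betw_cong[THEN iffD1, rotated]) (use assms(3) in auto)
    have "f(i := undefined) \<in> A \<rightarrow>\<^sub>E (B - {f i})"
      using b' f assms(3) by (auto simp: PiE_iff bij_betw_def extensional_def)
    with b' f show "(f i, f(i := undefined))
      \<in> Sigma B (\<lambda>j. {f. f \<in> A \<rightarrow>\<^sub>E (B - {j}) \<and> bij_betw f A (B - {j})})" by auto
    have "(\<Prod>l\<in>A. d l ((f(i := undefined)) l)) = (\<Prod>l\<in>A. d l (f l))"
      using assms(3) by (intro prod.cong) auto
    then show "(case (f i, f(i := undefined)) of (j, f) \<Rightarrow> d i j * (\<Prod>l\<in>A. d l (f l))) =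
        (\<Prod>l\<in>insert i A. d l (f l))"
      using assms by simp
  next
    fix y assume "y \<in> Sigma B (\<lambda>j. {f. f \<in> A \<rightarrow>\<^sub>E (B - {j}) \<and> bij_betw f A (B - {j})})"
    then obtain j f where y: "y = (j, f)" "j \<in> B" and f: "f \<in> A \<rightarrow>\<^sub>E (B - {j})"
      and b: "bij_betw f A (B - {j})" by auto
    have fi: "f i = undefined" using f assms(3) by (auto simp: PiE_iff extensional_def)
    then show "((case y of (j, f) \<Rightarrow> f(i := j)) i, (case y of (j, f) \<Rightarrow> f(i := j))(i := undefined)) = y"
      using y fi by auto
    have "bij_betw (f(i := j)) A (B - {j})"
      using b by (rule bij_betw_cong[THEN iffD1, rotated]) (use assms(3) in auto)
    then have "bij_betw (f(i := j)) (insert i A) (insert j (B - {j}))"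
      using assms(3) by (intro bij_betw_combine[of _ "{i}" "{j}", simplified]) auto
    then have "bij_betw (f(i := j)) (insert i A) B"
      using y(2) by (simp add: insert_absorb)
    moreover have "f(i := j) \<in> insert i A \<rightarrow>\<^sub>E B"
      using f y(2) by (auto simp: PiE_iff extensional_def)
    ultimately show "(case y of (j, f) \<Rightarrow> f(i := j)) \<in>
        {f. f \<in> insert i A \<rightarrow>\<^sub>E B \<and> bij_betw f (insert i A) B}"
      by (simp add: y)
  qed auto
  also have "\<dots> = (\<Sum>j\<in>B. d i j * per d A (B - {j}))"
    using assms fin by (subst sum.Sigma[symmetric]) (auto simp: per_def sum_distrib_left)
  finally show ?thesis .
qed

lemma per_card_neq:
  assumes "card A \<noteq> card B" shows "per d A B = 0"
proof -
  have "{f. f \<in> A \<rightarrow>\<^sub>E B \<and> bij_betw f A B} = {}"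
    using assms bij_betw_same_card by blast
  then show ?thesis by (simp only: per_def sum.empty)
qed

text \<open>Invariance under transposition: each bijection is replaced by its inverse.\<close>

lemma per_swap:
  "per d A B = per (\<lambda>i j. d j i) B A"
proof -
  \<comment> \<open>Stated for arbitrary \<open>A\<close> and \<open>B\<close> because both
    directions of the reindexing need it, the second with the two sets exchanged.\<close>
  have inv: "restrict (inv_into A f) B \<in> {f. f \<in> B \<rightarrow>\<^sub>E A \<and> bij_betw f B A}"
      "restrict (inv_into B (restrict (inv_into A f) B)) A = f"
    if "f \<in> {f. f \<in> A \<rightarrow>\<^sub>E B \<and> bij_betw f A B}" for f and A B :: "nat set"
  proof -
    let ?g = "restrict (inv_into A f) B"
    from that have b: "bij_betw f A B" and e: "f \<in> A \<rightarrow>\<^sub>E B" by auto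
    have b': "bij_betw ?g B A"
      using bij_betw_inv_into[OF b] by (rule bij_betw_cong[THEN iffD1, rotated]) auto
    then show "?g \<in> {f. f \<in> B \<rightarrow>\<^sub>E A \<and> bij_betw f B A}"
      by (auto simp: bij_betw_def)
    have "inv_into B ?g a = f a" if "a \<in> A" for a
    proof (rule inv_into_f_eq)
      show "inj_on ?g B" using b' by (simp add: bij_betw_def)
      show "f a \<in> B" using b that by (auto simp: bij_betw_def)
      then show "?g (f a) = a" using b that by (simp add: bij_betw_inv_into_left)
    qed
    then show "restrict (inv_into B ?g) A = f"
      using e by (auto simp: PiE_iff extensional_def fun_eq_iff)
  qed
  show ?thesis
    unfolding per_def
  proof (rule sum.reindex_bij_witness[of _ "\<lambda>g. restrict (inv_into B g) A" "\<lambda>f. restrict (inv_into A f) B"])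
    fix f assume f: "f \<in> {f. f \<in> A \<rightarrow>\<^sub>E B \<and> bij_betw f A B}"
    then have b: "bij_betw f A B" by simp
    show "restrict (inv_into A f) B \<in> {f. f \<in> B \<rightarrow>\<^sub>E A \<and> bij_betw f B A}"
      "restrict (inv_into B (restrict (inv_into A f) B)) A = f"
      using inv[OF f] by blast+
    show "(\<Prod>i\<in>B. d (restrict (inv_into A f) B i) i) = (\<Prod>i\<in>A. d i (f i))"
      unfolding prod.reindex_bij_betw[symmetric, OF b]
      using b by (intro prod.cong) (auto simp: bij_betw_inv_into_left bij_betwE)
  next
    fix g assume g: "g \<in> {f. f \<in> B \<rightarrow>\<^sub>E A \<and> bij_betw f B A}"
    show "restrict (inv_into B g) A \<in> {f. f \<in> A \<rightarrow>\<^sub>E B \<and> bij_betw f A B}"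
      "restrict (inv_into A (restrict (inv_into B g) A)) B = g"
      using inv[OF g] by blast+
  qed
qed

section \<open>Weighted sums over cross pairings\<close>

text \<open>A weighted sum over the perfect matchings of the disjoint union of \<open>P\<close> and
  \<open>Q\<close>: \<open>d\<close> weighs the pairs across, \<open>w\<close> and \<open>w'\<close>
  the pairs within \<open>P\<close> and within \<open>Q\<close>, and \<open>c\<close> depends on the
  number of pairs across. Here \<open>A\<close> and \<open>B\<close> are the endpoints of the pairs
  across.\<close>

definition mixed_haf ::
    "(nat \<Rightarrow> nat \<Rightarrow> 'a::comm_ring_1) \<Rightarrow> (nat \<Rightarrow> nat \<Rightarrow> 'a) \<Rightarrow> (nat \<Rightarrow> nat \<Rightarrow> 'a) \<Rightarrow>
      (nat \<Rightarrow> 'a) \<Rightarrow> nat set \<Rightarrow> nat set \<Rightarrow> 'a" where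
  "mixed_haf d w w' c P Q =
     (\<Sum>A\<in>Pow P. \<Sum>B\<in>Pow Q. c (card A) * per d A B * haf w (P - A) * haf w' (Q - B))"

text \<open>The partner of \<open>v\<close> lies either in \<open>P\<close>, where the Hafnian is
  expanded, or in \<open>Q\<close>, where the permanent is. In the second case the pair of
  \<open>v\<close> is one more pair across, hence the shifted weight.\<close>

lemma mixed_haf_insert_left:
  assumes fin: "finite P" "finite Q" and v: "v \<notin> P" and sym: "\<And>a b. w a b = w b a"
  shows "mixed_haf d w w' c (insert v P) Q =
    (\<Sum>j\<in>P. w v j * mixed_haf d w w' c (P - {j}) Q) +
    (\<Sum>j\<in>Q. d v j * mixed_haf d w w' (\<lambda>\<mu>. c (Suc \<mu>)) P (Q - {j}))"
proof -
  have finP: "finite A" if "A \<subseteq> P" for A using that fin finite_subset by blast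
  have finQ: "finite B" if "B \<subseteq> Q" for B using that fin finite_subset by blast
  have "(\<Sum>A\<in>Pow P. \<Sum>B\<in>Pow Q. c (card A) * per d A B * haf w (insert v P - A) * haf w' (Q - B)) =
    (\<Sum>A\<in>Pow P. \<Sum>j\<in>P - A. \<Sum>B\<in>Pow Q.
      w v j * (c (card A) * per d A B * haf w (P - {j} - A) * haf w' (Q - B)))"
  proof (rule sum.cong[OF refl])
    fix A assume A: "A \<in> Pow P"
    have "insert v P - A = insert v (P - A)" using A v by auto
    then have "haf w (insert v P - A) = (\<Sum>j\<in>P - A. w v j * haf w (P - A - {j}))"
      using fin v sym by (simp add: haf_insert)
    also have "\<dots> = (\<Sum>j\<in>P - A. w v j * haf w (P - {j} - A))"
    proof -
      have "P - A - {j} = P - {j} - A" for j by auto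
      then show ?thesis by simp
    qed
    finally show "(\<Sum>B\<in>Pow Q. c (card A) * per d A B * haf w (insert v P - A) * haf w' (Q - B)) =
      (\<Sum>j\<in>P - A. \<Sum>B\<in>Pow Q.
        w v j * (c (card A) * per d A B * haf w (P - {j} - A) * haf w' (Q - B)))"
      by (subst sum.swap) (simp add: sum_distrib_left sum_distrib_right mult_ac)
  qed
  also have "\<dots> = (\<Sum>j\<in>P. w v j * mixed_haf d w w' c (P - {j}) Q)"
    by (simp add: sum_Pow_notin[OF fin(1)] mixed_haf_def sum_distrib_left)
  finally have out: "(\<Sum>A\<in>Pow P. \<Sum>B\<in>Pow Q. c (card A) * per d A B * haf w (insert v P - A) * haf w' (Q - B)) = \<dots>" .
  have "(\<Sum>A\<in>Pow P. \<Sum>B\<in>Pow Q. c (card (insert v A)) * per d (insert v A) B *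
      haf w (insert v P - insert v A) * haf w' (Q - B)) =
    (\<Sum>A\<in>Pow P. \<Sum>B\<in>Pow Q. \<Sum>j\<in>B.
      d v j * (c (Suc (card A)) * per d A (B - {j}) * haf w (P - A) * haf w' (Q - B)))"
  proof (intro sum.cong refl)
    fix A B assume A: "A \<in> Pow P" and B: "B \<in> Pow Q"
    have "v \<notin> A" using A v by auto
    moreover have "insert v P - insert v A = P - A" using v by auto
    ultimately show "c (card (insert v A)) * per d (insert v A) B *
        haf w (insert v P - insert v A) * haf w' (Q - B) =
      (\<Sum>j\<in>B. d v j * (c (Suc (card A)) * per d A (B - {j}) * haf w (P - A) * haf w' (Q - B)))"
      using A B finP[of A] finQ[of B]
      by (simp add: per_insert sum_distrib_left sum_distrib_right mult_ac)
  qed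
  also have "\<dots> = (\<Sum>A\<in>Pow P. \<Sum>j\<in>Q. \<Sum>B\<in>Pow (Q - {j}).
      d v j * (c (Suc (card A)) * per d A (insert j B - {j}) * haf w (P - A) * haf w' (Q - insert j B)))"
    by (simp only: sum_Pow_in[OF fin(2)])
  also have "\<dots> = (\<Sum>A\<in>Pow P. \<Sum>j\<in>Q. \<Sum>B\<in>Pow (Q - {j}).
      d v j * (c (Suc (card A)) * per d A B * haf w (P - A) * haf w' (Q - {j} - B)))"
  proof (intro sum.cong refl)
    fix A j B assume "B \<in> Pow (Q - {j})"
    then have "insert j B - {j} = B" "Q - insert j B = Q - {j} - B" by auto
    then show "d v j * (c (Suc (card A)) * per d A (insert j B - {j}) * haf w (P - A) * haf w' (Q - insert j B)) =
      d v j * (c (Suc (card A)) * per d A B * haf w (P - A) * haf w' (Q - {j} - B))" by simp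
  qed
  also have "\<dots> = (\<Sum>j\<in>Q. d v j * mixed_haf d w w' (\<lambda>\<mu>. c (Suc \<mu>)) P (Q - {j}))"
    by (subst sum.swap) (simp add: mixed_haf_def sum_distrib_left)
  finally show ?thesis
    using out by (simp add: mixed_haf_def sum_Pow_insert fin v)
qed

text \<open>The weight is read from \<open>card A\<close>, but the permanent vanishes unless
  \<open>card A = card B\<close>, so it may equally be read from \<open>card B\<close>.\<close>

lemma mixed_haf_swap:
  "mixed_haf d w w' c P Q = mixed_haf (\<lambda>i j. d j i) w' w c Q P"
proof -
  have "c (card A) * per d A B * haf w (P - A) * haf w' (Q - B) =
      c (card B) * per (\<lambda>i j. d j i) B A * haf w' (Q - B) * haf w (P - A)" for A B
    using per_card_neq[of A B d] by (cases "card A = card B") (simp_all add: per_swap[of d A B] mult_ac)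
  then show ?thesis
    unfolding mixed_haf_def by (subst sum.swap) simp
qed

lemma mixed_haf_insert_right:
  assumes "finite P" "finite Q" "v \<notin> Q" "\<And>a b. w' a b = w' b a"
  shows "mixed_haf d w w' c P (insert v Q) =
    (\<Sum>j\<in>Q. w' v j * mixed_haf d w w' c P (Q - {j})) +
    (\<Sum>i\<in>P. d i v * mixed_haf d w w' (\<lambda>\<mu>. c (Suc \<mu>)) (P - {i}) Q)"
  unfolding mixed_haf_swap[of d w w']
  using mixed_haf_insert_left[of Q P v w' "\<lambda>i j. d j i" w c] assms by simp

lemma mixed_haf_remove_left:
  assumes "finite P" "finite Q" "i \<in> P" "\<And>a b. w a b = w b a"
  shows "mixed_haf d w w' c P Q =
    (\<Sum>j\<in>P - {i}. w i j * mixed_haf d w w' c (P - {i} - {j}) Q) +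
    (\<Sum>j\<in>Q. d i j * mixed_haf d w w' (\<lambda>\<mu>. c (Suc \<mu>)) (P - {i}) (Q - {j}))"
  using mixed_haf_insert_left[of "P - {i}" Q i w d w' c] assms by (simp add: insert_absorb)

text \<open>A matching with \<mu> pairs across arises once for each choice of one of them as the
  pair taken out. The rest has one pair fewer, hence the weight at \<open>\<mu> - 1\<close>; at 0
  the factor vanishes.\<close>

lemma mixed_haf_cross:
  assumes fin: "finite P" "finite Q"
  shows "(\<Sum>i\<in>P. \<Sum>j\<in>Q. d i j * mixed_haf d w w' c (P - {i}) (Q - {j})) =
    mixed_haf d w w' (\<lambda>\<mu>. of_nat \<mu> * c (\<mu> - 1)) P Q"
proof -
  let ?h = "\<lambda>A B. haf w (P - A) * haf w' (Q - B)"
  \<comment> \<open>The inner sum is the expansion along row \<open>i\<close>, so every row of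
    \<open>A\<close> contributes the whole permanent once.\<close>
  have rowsum: "(\<Sum>i\<in>A. \<Sum>j\<in>B. d i j * per d (A - {i}) (B - {j})) = of_nat (card A) * per d A B"
    if "A \<subseteq> P" "B \<subseteq> Q" for A B
  proof -
    have "finite A" "finite B" using that fin finite_subset by blast+
    then have "(\<Sum>j\<in>B. d i j * per d (A - {i}) (B - {j})) = per d A B" if "i \<in> A" for i
      using per_insert[of "A - {i}" B i d] that by (simp add: insert_absorb)
    then show ?thesis by simp
  qed
  have "(\<Sum>i\<in>P. \<Sum>j\<in>Q. d i j * mixed_haf d w w' c (P - {i}) (Q - {j})) =
    (\<Sum>i\<in>P. \<Sum>A\<in>Pow (P - {i}). \<Sum>j\<in>Q. \<Sum>B\<in>Pow (Q - {j}).
      d i j * (c (card A) * per d A B * haf w (P - {i} - A) * haf w' (Q - {j} - B)))"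
    by (intro sum.cong[OF refl], subst sum.swap) (simp add: mixed_haf_def sum_distrib_left)
  \<comment> \<open>Everything is expressed through \<open>insert i A\<close> and
    \<open>insert j B\<close>, so that both double sums fold back into sums over subsets with a
    marked element.\<close>
  also have "\<dots> = (\<Sum>i\<in>P. \<Sum>A\<in>Pow (P - {i}). \<Sum>j\<in>Q. \<Sum>B\<in>Pow (Q - {j}).
      d i j * (c (card (insert i A) - 1) * per d (insert i A - {i}) (insert j B - {j}) * ?h (insert i A) (insert j B)))"
  proof (intro sum.cong refl)
    fix i A j B assume A: "A \<in> Pow (P - {i})" and B: "B \<in> Pow (Q - {j})"
    then have "finite A" "i \<notin> A" "insert i A - {i} = A" "insert j B - {j} = B"
        "P - {i} - A = P - insert i A" "Q - {j} - B = Q - insert j B"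
      using fin by (auto intro: finite_subset)
    then show "d i j * (c (card A) * per d A B * haf w (P - {i} - A) * haf w' (Q - {j} - B)) =
      d i j * (c (card (insert i A) - 1) * per d (insert i A - {i}) (insert j B - {j}) * ?h (insert i A) (insert j B))"
      by (simp add: mult.assoc)
  qed
  also have "\<dots> = (\<Sum>i\<in>P. \<Sum>A\<in>Pow (P - {i}). \<Sum>B\<in>Pow Q. \<Sum>j\<in>B.
      d i j * (c (card (insert i A) - 1) * per d (insert i A - {i}) (B - {j}) * ?h (insert i A) B))"
    by (simp only: sum_Pow_in[OF fin(2)])
  also have "\<dots> = (\<Sum>A\<in>Pow P. \<Sum>i\<in>A. \<Sum>B\<in>Pow Q. \<Sum>j\<in>B.
      d i j * (c (card A - 1) * per d (A - {i}) (B - {j}) * ?h A B))"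
    by (simp only: sum_Pow_in[OF fin(1)])
  also have "\<dots> = (\<Sum>A\<in>Pow P. \<Sum>B\<in>Pow Q. c (card A - 1) * ?h A B *
      (\<Sum>i\<in>A. \<Sum>j\<in>B. d i j * per d (A - {i}) (B - {j})))"
    by (intro sum.cong[OF refl], subst sum.swap) (simp add: sum_distrib_left mult_ac)
  also have "\<dots> = mixed_haf d w w' (\<lambda>\<mu>. of_nat \<mu> * c (\<mu> - 1)) P Q"
    unfolding mixed_haf_def by (intro sum.cong refl) (simp add: rowsum mult_ac)
  finally show ?thesis .
qed

lemma mixed_haf_add:
  "mixed_haf d w w' (\<lambda>\<mu>. c \<mu> + c' \<mu>) P Q = mixed_haf d w w' c P Q + mixed_haf d w w' c' P Q"
  unfolding mixed_haf_def sum.distrib[symmetric] by (simp add: distrib_right)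

lemma mixed_haf_diff:
  "mixed_haf d w w' (\<lambda>\<mu>. c \<mu> - c' \<mu>) P Q = mixed_haf d w w' c P Q - mixed_haf d w w' c' P Q"
  unfolding mixed_haf_def sum_subtractf[symmetric] by (simp add: left_diff_distrib)

lemma mixed_haf_scale:
  "mixed_haf d w w' (\<lambda>\<mu>. r * c \<mu>) P Q = r * mixed_haf d w w' c P Q"
  unfolding mixed_haf_def sum_distrib_left by (simp add: mult.assoc)

text \<open>Summing the expansion along \<open>i\<close> over all \<open>i \<in> P\<close> counts every term \<open>card P\<close> times; the
  pairs of \<open>P\<close> account for what the cross pairs leave over.\<close>

lemma mixed_haf_pairs_left:
  assumes "finite P" "finite Q" "\<And>a b. w a b = w b a"
  shows "(\<Sum>i\<in>P. \<Sum>j\<in>P - {i}. w i j * mixed_haf d w w' c (P - {i} - {j}) Q) =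
    mixed_haf d w w' (\<lambda>\<mu>. (of_nat (card P) - of_nat \<mu>) * c \<mu>) P Q"
proof -
  have "of_nat (card P) * mixed_haf d w w' c P Q = (\<Sum>i\<in>P. mixed_haf d w w' c P Q)"
    by simp
  also have "\<dots> = (\<Sum>i\<in>P. \<Sum>j\<in>P - {i}. w i j * mixed_haf d w w' c (P - {i} - {j}) Q) +
      (\<Sum>i\<in>P. \<Sum>j\<in>Q. d i j * mixed_haf d w w' (\<lambda>\<mu>. c (Suc \<mu>)) (P - {i}) (Q - {j}))"
    unfolding sum.distrib[symmetric]
    using assms by (intro sum.cong refl mixed_haf_remove_left) auto
  also have "(\<Sum>i\<in>P. \<Sum>j\<in>Q. d i j * mixed_haf d w w' (\<lambda>\<mu>. c (Suc \<mu>)) (P - {i}) (Q - {j})) =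
      mixed_haf d w w' (\<lambda>\<mu>. of_nat \<mu> * c \<mu>) P Q"
  proof -
    \<comment> \<open>At 0 truncated subtraction would read \<open>c 1\<close> instead of
      \<open>c 0\<close>, but the factor in front is 0.\<close>
    have "(\<lambda>\<mu>. of_nat \<mu> * c (Suc (\<mu> - 1))) = (\<lambda>\<mu>. of_nat \<mu> * c \<mu>)"
      by (rule ext, case_tac \<mu>) auto
    then show ?thesis using assms(1,2) by (simp add: mixed_haf_cross)
  qed
  finally show ?thesis
    by (simp add: left_diff_distrib mixed_haf_diff mixed_haf_scale)
qed

lemma mixed_haf_pairs_right:
  assumes "finite P" "finite Q" "\<And>a b. w' a b = w' b a"
  shows "(\<Sum>i\<in>Q. \<Sum>j\<in>Q - {i}. w' i j * mixed_haf d w w' c P (Q - {i} - {j})) =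
    mixed_haf d w w' (\<lambda>\<mu>. (of_nat (card Q) - of_nat \<mu>) * c \<mu>) P Q"
  unfolding mixed_haf_swap[of d w w']
  using mixed_haf_pairs_left[of Q P w' "\<lambda>i j. d j i" w c] assms by simp

text \<open>Two copies of \<open>v\<close> are added, one on each side. In order, the terms are:
  both are paired within their own side; only the right copy is paired across; only the left copy
  is; both are paired across with old points; the copies are paired with each other.\<close>

lemma mixed_haf_insert_both:
  assumes fin: "finite P" "finite Q" and v: "v \<notin> P" "v \<notin> Q"
    and sym: "\<And>a b. w a b = w b a" "\<And>a b. w' a b = w' b a"
  shows "mixed_haf d w w' c (insert v P) (insert v Q) =
    (\<Sum>i\<in>P. \<Sum>j\<in>Q. w v i * w' v j * mixed_haf d w w' c (P - {i}) (Q - {j})) +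
    (\<Sum>i\<in>P. \<Sum>j\<in>P - {i}. w v i * d j v * mixed_haf d w w' (\<lambda>\<mu>. c (Suc \<mu>)) (P - {i} - {j}) Q) +
    (\<Sum>i\<in>Q. \<Sum>j\<in>Q - {i}. d v i * w' v j * mixed_haf d w w' (\<lambda>\<mu>. c (Suc \<mu>)) P (Q - {i} - {j})) +
    (\<Sum>i\<in>P. \<Sum>j\<in>Q. d i v * d v j * mixed_haf d w w' (\<lambda>\<mu>. c (Suc (Suc \<mu>))) (P - {i}) (Q - {j})) +
    d v v * mixed_haf d w w' (\<lambda>\<mu>. c (Suc \<mu>)) P Q"
proof -
  let ?M = "mixed_haf d w w'"
  have 1: "?M c (insert v P) (insert v Q) = (\<Sum>i\<in>P. w v i * ?M c (P - {i}) (insert v Q)) +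
      (\<Sum>j\<in>insert v Q. d v j * ?M (\<lambda>\<mu>. c (Suc \<mu>)) P (insert v Q - {j}))"
    using fin v sym by (intro mixed_haf_insert_left) auto
  have 2: "(\<Sum>i\<in>P. w v i * ?M c (P - {i}) (insert v Q)) =
      (\<Sum>i\<in>P. \<Sum>j\<in>Q. w v i * w' v j * ?M c (P - {i}) (Q - {j})) +
      (\<Sum>i\<in>P. \<Sum>j\<in>P - {i}. w v i * d j v * ?M (\<lambda>\<mu>. c (Suc \<mu>)) (P - {i} - {j}) Q)"
    using mixed_haf_insert_right[of _ Q v w' d w c] fin v sym(2)
    by (simp add: sum.distrib sum_distrib_left distrib_left mult.assoc)
  \<comment> \<open>The value \<open>j = v\<close> pairs the two copies with each other and is split
    off.\<close>
  have "(\<Sum>j\<in>insert v Q. d v j * ?M (\<lambda>\<mu>. c (Suc \<mu>)) P (insert v Q - {j})) =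
      d v v * ?M (\<lambda>\<mu>. c (Suc \<mu>)) P Q +
      (\<Sum>j\<in>Q. d v j * ?M (\<lambda>\<mu>. c (Suc \<mu>)) P (insert v (Q - {j})))"
  proof -
    have "insert v Q - {v} = Q" "insert v Q - {j} = insert v (Q - {j})" if "j \<in> Q" for j
      using v that by auto
    then show ?thesis using fin v by (simp add: Diff_triv)
  qed
  moreover have "(\<Sum>j\<in>Q. d v j * ?M (\<lambda>\<mu>. c (Suc \<mu>)) P (insert v (Q - {j}))) =
      (\<Sum>i\<in>Q. \<Sum>j\<in>Q - {i}. d v i * w' v j * ?M (\<lambda>\<mu>. c (Suc \<mu>)) P (Q - {i} - {j})) +
      (\<Sum>j\<in>Q. \<Sum>i\<in>P. d i v * d v j * ?M (\<lambda>\<mu>. c (Suc (Suc \<mu>))) (P - {i}) (Q - {j}))"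
    using mixed_haf_insert_right[of P _ v w' d w "\<lambda>\<mu>. c (Suc \<mu>)"] fin v sym(2)
    by (simp add: sum.distrib sum_distrib_left distrib_left mult_ac)
  ultimately show ?thesis
    using 1 2 by (simp add: sum.swap[of _ P Q] add_ac)
qed

lemma mixed_haf_cong:
  assumes "finite P" "finite Q"
    and "\<And>i j. i \<in> P \<Longrightarrow> j \<in> Q \<Longrightarrow> d i j = d' i j"
    and "\<And>i j. i \<in> P \<Longrightarrow> j \<in> P \<Longrightarrow> w i j = u i j"
    and "\<And>i j. i \<in> Q \<Longrightarrow> j \<in> Q \<Longrightarrow> w' i j = u' i j"
  shows "mixed_haf d w w' c P Q = mixed_haf d' u u' c P Q"
  unfolding mixed_haf_def
proof (intro sum.cong refl)
  fix A B assume AB: "A \<in> Pow P" "B \<in> Pow Q"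
  have "per d A B = per d' A B"
    unfolding per_def
    by (intro sum.cong prod.cong refl) (use AB in \<open>auto simp: PiE_iff intro!: assms(3)\<close>)
  moreover have "haf w (P - A) = haf u (P - A)" "haf w' (Q - B) = haf u' (Q - B)"
    using assms by (auto intro!: haf_cong)
  ultimately show "c (card A) * per d A B * haf w (P - A) * haf w' (Q - B) =
      c (card A) * per d' A B * haf u (P - A) * haf u' (Q - B)" by simp
qed

section \<open>Matrices and index sets\<close>

text \<open>The inverse of the increasing enumeration sends an element of \<open>I\<close> to its
  rank.\<close>

lemma bij_betw_pick:
  assumes "finite I" shows "bij_betw (pick I) {..<card I} I"
proof (rule bij_betw_byWitness[where f' = "\<lambda>i. card {a\<in>I. a < i}"])
  show "\<forall>i\<in>{..<card I}. card {a \<in> I. a < pick I i} = i" by (simp add: card_pick_le)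
  show "\<forall>i\<in>I. pick I (card {a \<in> I. a < i}) = i" by (simp add: pick_card_in_set)
  show "pick I ` {..<card I} \<subseteq> I" by (auto intro: pick_in_set_le)
  show "(\<lambda>i. card {a \<in> I. a < i}) ` I \<subseteq> {..<card I}"
    using assms by (auto intro!: psubset_card_mono)
qed

lemma hafnian_mat:
  "hafnian (mat r r (\<lambda>(i, j). w i j)) = haf w {..<r}"
proof -
  have "hafnian (mat r r (\<lambda>(i, j). w i j)) =
      haf (\<lambda>i j. mat r r (\<lambda>(i, j). w i j) $$ (i, j)) {..<r}"
    by (simp add: hafnian_def haf_def)
  also have "\<dots> = haf w {..<r}" by (rule haf_cong) auto
  finally show ?thesis .
qed

text \<open>Taking a submatrix renumbers \<open>a\<close> by \<open>pick a\<close>, and the Hafnian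
  of a symmetric weight is invariant under renumbering.\<close>

lemma hafnian_submatrix:
  assumes a: "a \<subseteq> {..<r}" and sym: "\<And>i j. w i j = w j i"
    and M: "dim_row M = r" "dim_col M = r" "\<And>i j. i < r \<Longrightarrow> j < r \<Longrightarrow> M $$ (i, j) = w i j"
  shows "hafnian (submatrix M a a) = haf w a"
proof -
  have fin: "finite a" using a finite_subset by blast
  note bij = bij_betw_pick[OF fin]
  have "{i. i < r \<and> i \<in> a} = a" using a by auto
  then have "submatrix M a a = mat (card a) (card a) (\<lambda>(i, j). M $$ (pick a i, pick a j))"
    by (simp add: submatrix_def M)
  then have "hafnian (submatrix M a a) = haf (\<lambda>i j. M $$ (pick a i, pick a j)) {..<card a}"
    by (simp add: hafnian_mat)
  also have "\<dots> = haf (\<lambda>i j. w (pick a i) (pick a j)) {..<card a}"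
  proof (rule haf_cong)
    have "pick a i < r" if "i < card a" for i
      using bij_betwE[OF bij] that a by blast
    then show "M $$ (pick a i, pick a j) = w (pick a i) (pick a j)"
      if "i \<in> {..<card a}" "j \<in> {..<card a}" for i j
      using that M(3) by simp
  qed simp
  also have "\<dots> = haf w a"
    using haf_image[of "{..<card a}" "pick a" w] bij sym by (simp add: bij_betw_def)
  finally show ?thesis .
qed

lemma per_image:
  assumes "finite A" "finite B" "inj_on g A" "inj_on h B"
  shows "per d (g ` A) (h ` B) = per (\<lambda>i j. d (g i) (h j)) A B"
  using assms
proof (induction A arbitrary: B rule: finite_induct)
  case empty
  then show ?case by (simp add: per_empty)
next
  case (insert i A)
  have gi: "g i \<notin> g ` A" using insert by auto
  have "per d (g ` insert i A) (h ` B) = (\<Sum>j\<in>B. d (g i) (h j) * per d (g ` A) (h ` B - {h j}))"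
    using insert gi by (simp add: per_insert sum.reindex)
  also have "\<dots> = (\<Sum>j\<in>B. d (g i) (h j) * per (\<lambda>i j. d (g i) (h j)) A (B - {j}))"
  proof (rule sum.cong[OF refl])
    fix j assume "j \<in> B"
    then have "h ` B - {h j} = h ` (B - {j})" using insert.prems by (auto simp: inj_on_def)
    moreover have "per d (g ` A) (h ` (B - {j})) = per (\<lambda>i j. d (g i) (h j)) A (B - {j})"
      using insert.prems by (intro insert.IH) (auto intro: inj_on_diff)
    ultimately show "d (g i) (h j) * per d (g ` A) (h ` B - {h j}) =
        d (g i) (h j) * per (\<lambda>i j. d (g i) (h j)) A (B - {j})" by simp
  qed
  also have "\<dots> = per (\<lambda>i j. d (g i) (h j)) (insert i A) B"
    using insert by (simp add: per_insert)
  finally show ?case .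
qed

lemma permanent_mat:
  "permanent (mat r r (\<lambda>(i, j). d i j)) = per d {..<r} {..<r}"
proof -
  have "permanent (mat r r (\<lambda>(i, j). d i j)) = (\<Sum>\<pi> | \<pi> permutes {..<r}. \<Prod>i<r. d i (\<pi> i))"
  proof -
    have "\<pi> i < r" if "\<pi> permutes {..<r}" "i < r" for \<pi> i
      using permutes_in_image[OF that(1), of i] that(2) by simp
    then show ?thesis by (simp add: permanent_def)
  qed
  also have "\<dots> = per d {..<r} {..<r}"
    unfolding per_def
  \<comment> \<open>Permutations are the identity outside \<open>{..<r}\<close>, extensional
    functions are \<open>undefined\<close> there. The two maps only exchange these
    conventions.\<close>
  proof (rule sum.reindex_bij_witness[of _ "\<lambda>f i. if i < r then f i else i" "\<lambda>\<pi>. restrict \<pi> {..<r}"])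
    fix \<pi> assume "\<pi> \<in> {\<pi>. \<pi> permutes {..<r}}"
    then have p: "\<pi> permutes {..<r}" by simp
    then show "(\<lambda>i. if i < r then restrict \<pi> {..<r} i else i) = \<pi>"
      by (auto simp: fun_eq_iff permutes_def)
    have "bij_betw (restrict \<pi> {..<r}) {..<r} {..<r}"
      using permutes_imp_bij[OF p] by (rule bij_betw_cong[THEN iffD1, rotated]) auto
    then show "restrict \<pi> {..<r} \<in> {f \<in> {..<r} \<rightarrow>\<^sub>E {..<r}. bij_betw f {..<r} {..<r}}"
      by (auto simp: bij_betw_def)
  next
    fix f assume "f \<in> {f \<in> {..<r} \<rightarrow>\<^sub>E {..<r}. bij_betw f {..<r} {..<r}}"
    then have f: "f \<in> {..<r} \<rightarrow>\<^sub>E {..<r}" and b: "bij_betw f {..<r} {..<r}" by auto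
    then show "restrict (\<lambda>i. if i < r then f i else i) {..<r} = f"
      by (auto simp: fun_eq_iff PiE_iff extensional_def)
    have "bij_betw (\<lambda>i. if i < r then f i else i) {..<r} {..<r}"
      using b by (rule bij_betw_cong[THEN iffD1, rotated]) auto
    then show "(\<lambda>i. if i < r then f i else i) \<in> {\<pi>. \<pi> permutes {..<r}}"
      by (intro CollectI bij_imp_permutes) auto
  qed auto
  finally show ?thesis .
qed

text \<open>Equal cardinalities make the submatrix square, which \<open>permanent\<close> presumes,
  since it reads only the number of rows. Rows and columns are renumbered separately.\<close>

lemma permanent_S_mat:
  assumes AB: "A \<subseteq> {..<length x}" "B \<subseteq> {..<length x}" and card: "card A = card B"
  shows "permanent (S_mat x A B) = per (\<lambda>i j. of_bool (x ! i = x ! j)) A B"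
proof -
  have fin: "finite A" "finite B" using AB finite_subset by blast+
  note bij = bij_betw_pick[OF fin(1)] bij_betw_pick[OF fin(2)]
  have "{i. i < length x \<and> i \<in> A} = A" "{i. i < length x \<and> i \<in> B} = B" using AB by auto
  moreover have "pick A i < length x" "pick B i < length x" if "i < card A" for i
    using bij AB card that unfolding bij_betw_def by fastforce+
  ultimately have "S_mat x A B =
      mat (card A) (card A) (\<lambda>(i, j). of_bool (x ! pick A i = x ! pick B j))"
    using card by (intro eq_matI) (auto simp: S_mat_def submatrix_def)
  then have "permanent (S_mat x A B) =
      per (\<lambda>i j. of_bool (x ! pick A i = x ! pick B j)) {..<card A} {..<card A}"
    by (simp add: permanent_mat)
  also have "\<dots> = per (\<lambda>i j. of_bool (x ! i = x ! j)) A B"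
    using per_image[of "{..<card A}" "{..<card B}" "pick A" "pick B"
        "\<lambda>i j. of_bool (x ! i = x ! j) :: complex"] bij card
    by (simp add: bij_betw_def)
  finally show ?thesis .
qed

section \<open>Coefficients\<close>

text \<open>The generalised binomial coefficient, extended by 0 to negative lower index, so that
  Pascal's rule holds for all integers.\<close>

definition zbinom :: "real \<Rightarrow> int \<Rightarrow> real" where
  "zbinom N t = (if t < 0 then 0 else N gchoose nat t)"

lemma zbinom_neg: "t < 0 \<Longrightarrow> zbinom N t = 0"
  by (simp add: zbinom_def)

lemma zbinom_0 [simp]: "zbinom N 0 = 1"
  by (simp add: zbinom_def)

lemma int_neg_0_Suc_cases:
  fixes t :: int
  obtains "t < 0" | "t = 0" | q where "t = int (Suc q)"
proof (cases "t < 0")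
  case False
  then obtain n where "t = int n" by (meson nonneg_int_cases linorder_not_less)
  then show ?thesis using that(2,3) by (cases n) auto
qed (rule that(1))

lemma zbinom_pascal: "zbinom (N + 1) t = zbinom N t + zbinom N (t - 1)"
proof (cases t rule: int_neg_0_Suc_cases)
  case (3 q)
  then show ?thesis
    using gbinomial_Suc_Suc[of N q] by (simp add: zbinom_def nat_add_distrib)
qed (simp_all add: zbinom_def)

lemma zbinom_absorb: "of_int t * zbinom N t = (N - of_int t + 1) * zbinom N (t - 1)"
proof (cases t rule: int_neg_0_Suc_cases)
  case (3 q)
  then show ?thesis
    using gbinomial_mult_1[of N q] by (simp add: zbinom_def nat_add_distrib algebra_simps)
qed (simp_all add: zbinom_def)

text \<open>The weight of \<mu> cross pairs among \<open>k\<close> fixed positions once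
  \<open>l\<close> further coordinates are summed out. It is 0 also for \<mu> above
  \<open>l\<close>, where the lower index is negative.\<close>

definition haf_coeff :: "nat \<Rightarrow> nat \<Rightarrow> nat \<Rightarrow> nat \<Rightarrow> real" where
  "haf_coeff m l k \<mu> = (if even (int l - int \<mu>)
     then fact l * zbinom (real k + (real m + real l - real \<mu>) / 2 - 1) ((int l - int \<mu>) div 2)
     else 0)"

lemma haf_coeff_0: "haf_coeff m 0 k \<mu> = (if \<mu> = 0 then 1 else 0)"
  by (auto simp: haf_coeff_def intro: zbinom_neg)

text \<open>With \<open>t\<close> half of \<open>l + 1 - \<mu>\<close>, all three weights are
  binomials with upper index \<open>N\<close> or \<open>N + 1\<close> and lower index
  \<open>t\<close> or \<open>t - 1\<close>. Pascal's rule and absorption then leave an identity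
  linear in \<mu>.\<close>

lemma haf_coeff_Suc:
  "haf_coeff m (Suc l) k \<mu> = real \<mu> * haf_coeff m l (Suc k) (\<mu> - 1) +
     (real m + 2 * real k - real \<mu>) * haf_coeff m l (Suc k) (Suc \<mu>)"
proof (cases "even (int (Suc l) - int \<mu>)")
  case True
  then obtain t where t: "int (Suc l) - int \<mu> = 2 * t" by (rule evenE)
  have tr: "real l + 1 - real \<mu> = 2 * real_of_int t"
    using arg_cong[OF t, of real_of_int] by simp
  define N where "N = real k + (real m + real (Suc l) - real \<mu>) / 2 - 1"
  have 1: "haf_coeff m (Suc l) k \<mu> = fact (Suc l) * zbinom N t"
    using t by (simp add: haf_coeff_def N_def)
  \<comment> \<open>For \<open>\<mu> = 0\<close> both sides are 0, so the truncated
    \<open>\<mu> - 1\<close> does no harm.\<close>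
  have 2: "real \<mu> * haf_coeff m l (Suc k) (\<mu> - 1) = real \<mu> * (fact l * zbinom (N + 1) t)"
  proof (cases \<mu>)
    case (Suc \<nu>)
    then have "int l - int \<nu> = 2 * t" using t by simp
    moreover have "real (Suc k) + (real m + real l - real \<nu>) / 2 - 1 = N + 1"
      by (simp add: N_def Suc field_simps)
    ultimately show ?thesis using Suc by (simp add: haf_coeff_def)
  qed simp
  have 3: "haf_coeff m l (Suc k) (Suc \<mu>) = fact l * zbinom N (t - 1)"
  proof -
    have "int l - int (Suc \<mu>) = 2 * (t - 1)" using t by simp
    moreover have "real (Suc k) + (real m + real l - real (Suc \<mu>)) / 2 - 1 = N"
      by (simp add: N_def field_simps)
    ultimately show ?thesis by (simp only: haf_coeff_def) simp
  qed
  \<comment> \<open>The absorption factor depends neither on \<open>l\<close> nor on \<mu>; this is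
    why the closed form satisfies the recursion.\<close>
  have "N - of_int t + 1 = real k + real m / 2"
    using tr by (simp add: N_def field_simps)
  then have "2 * of_int t * zbinom N t = (2 * real k + real m) * zbinom N (t - 1)"
    using zbinom_absorb[of t N] by (simp add: algebra_simps)
  then have "(real l + 1 - real \<mu>) * zbinom N t = (2 * real k + real m) * zbinom N (t - 1)"
    using tr by simp
  then have "real (Suc l) * zbinom N t = real \<mu> * zbinom (N + 1) t +
      (real m + 2 * real k - real \<mu>) * zbinom N (t - 1)"
    unfolding zbinom_pascal by (simp add: algebra_simps)
  then have "fact l * (real (Suc l) * zbinom N t) = fact l * (real \<mu> * zbinom (N + 1) t +
      (real m + 2 * real k - real \<mu>) * zbinom N (t - 1))" by simp
  then show ?thesis
    unfolding 1 2 3 by (simp add: algebra_simps)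
next
  case False
  then have "odd (int l - int (Suc \<mu>))" by simp
  moreover have "odd (int l - int (\<mu> - 1))" if "\<mu> \<noteq> 0"
    using False that by (cases \<mu>) auto
  ultimately show ?thesis using False by (auto simp: haf_coeff_def)
qed

text \<open>Pascal's rule, moved from the coefficients to the summand by an index shift. In this
  form it drives the inductions over binomial sums.\<close>

lemma sum_binomial_pascal:
  fixes g :: "nat \<Rightarrow> 'a::comm_semiring_1"
  shows "(\<Sum>j\<le>Suc r. of_nat (Suc r choose j) * g j) = (\<Sum>j\<le>r. of_nat (r choose j) * (g j + g (Suc j)))"
proof -
  have "(\<Sum>j\<le>Suc r. of_nat (Suc r choose j) * g j) =
      g 0 + (\<Sum>j\<le>r. of_nat (r choose Suc j) * g (Suc j)) + (\<Sum>j\<le>r. of_nat (r choose j) * g (Suc j))"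
    by (simp only: sum.atMost_Suc_shift binomial_Suc_Suc of_nat_add distrib_right sum.distrib) (simp add: add_ac)
  also have "g 0 + (\<Sum>j\<le>r. of_nat (r choose Suc j) * g (Suc j)) =
      (\<Sum>j\<le>Suc r. of_nat (r choose j) * g j)"
    by (simp only: sum.atMost_Suc_shift[of _ r]) simp
  also have "\<dots> = (\<Sum>j\<le>r. of_nat (r choose j) * g j)" by (simp add: binomial_eq_0)
  finally show ?thesis by (simp add: distrib_left sum.distrib)
qed

text \<open>Vandermonde's convolution, with \<open>r choose j\<close> in place of
  \<open>r choose (r - j)\<close>. Each induction step merges two neighbouring terms by Pascal's
  rule and raises \<open>N\<close> by one.\<close>

lemma zbinom_vandermonde:
  "(\<Sum>j\<le>r. real (r choose j) * zbinom N (t + int j - int r)) = zbinom (N + real r) t"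
proof (induction r arbitrary: N)
  case (Suc r)
  have "(\<Sum>j\<le>Suc r. real (Suc r choose j) * zbinom N (t + int j - int (Suc r))) =
      (\<Sum>j\<le>r. real (r choose j) * zbinom (N + 1) (t + int j - int r))"
  proof -
    have "zbinom N (t + int j - int (Suc r)) + zbinom N (t + int (Suc j) - int (Suc r)) =
        zbinom (N + 1) (t + int j - int r)" for j
      using zbinom_pascal[of N "t + int j - int r"] by (simp add: algebra_simps)
    then show ?thesis unfolding sum_binomial_pascal by simp
  qed
  also have "\<dots> = zbinom (N + 1 + real r) t" by (rule Suc.IH)
  finally show ?case by (simp add: add_ac)
qed simp

text \<open>Each perfect matching of \<open>I\<close> arises once for every choice of which of its pairs lie in \<open>a\<close>.\<close>

lemma haf_split:
  assumes "finite I" and sym: "\<And>a b. w a b = w b a"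
  shows "(\<Sum>a\<in>Pow I. \<phi> (card a) * haf w a * haf w (I - a)) =
    (\<Sum>j\<le>card I div 2. of_nat (card I div 2 choose j) * \<phi> (2 * j)) * haf w I"
  using assms(1)
proof (induction "card I" arbitrary: I \<phi> rule: less_induct)
  case less
  show ?case
  proof (cases "I = {}")
    case False
    then obtain i where i: "i \<in> I" by auto
    define J where "J = I - {i}"
    have I: "I = insert i J" and J: "i \<notin> J" "finite J" using i less.prems by (auto simp: J_def)
    have finJ: "finite a" if "a \<subseteq> J" for a using that J finite_subset by blast
    \<comment> \<open>Subsets without \<open>i\<close>: the partner of \<open>i\<close> lies in the
      complement, and the size of \<open>a\<close> is unchanged.\<close>
    have out: "(\<Sum>a\<in>Pow J. \<phi> (card a) * haf w a * haf w (I - a)) =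
        (\<Sum>j\<in>J. w i j * (\<Sum>a\<in>Pow (J - {j}). \<phi> (card a) * haf w a * haf w (J - {j} - a)))"
    proof -
      have "\<phi> (card a) * haf w a * haf w (I - a) =
          (\<Sum>j\<in>J - a. w i j * (\<phi> (card a) * haf w a * haf w (J - {j} - a)))" if "a \<in> Pow J" for a
      proof -
        have "I - a = insert i (J - a)" using that J by (auto simp: I)
        then have "haf w (I - a) = (\<Sum>j\<in>J - a. w i j * haf w (J - a - {j}))"
          using J sym by (simp add: haf_insert)
        moreover have "J - a - {j} = J - {j} - a" for j by auto
        ultimately show ?thesis by (simp add: sum_distrib_left mult_ac)
      qed
      then show ?thesis by (simp add: sum_Pow_notin[OF J(2)] sum_distrib_left)
    qed
    \<comment> \<open>Subsets containing \<open>i\<close>: its partner lies in \<open>a\<close> as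
      well, so removing the pair lowers the size by two.\<close>
    have inn: "(\<Sum>a\<in>Pow J. \<phi> (card (insert i a)) * haf w (insert i a) * haf w (I - insert i a)) =
        (\<Sum>j\<in>J. w i j * (\<Sum>a\<in>Pow (J - {j}). \<phi> (Suc (Suc (card a))) * haf w a * haf w (J - {j} - a)))"
    proof -
      have "\<phi> (card (insert i a)) * haf w (insert i a) * haf w (I - insert i a) =
          (\<Sum>j\<in>a. w i j * (\<phi> (Suc (card a)) * haf w (a - {j}) * haf w (J - a)))" if "a \<in> Pow J" for a
      proof -
        have "I - insert i a = J - a" "i \<notin> a" using that J by (auto simp: I)
        then show ?thesis using J sym that finJ[of a]
          by (simp add: haf_insert sum_distrib_left sum_distrib_right mult_ac)
      qed
      then have "(\<Sum>a\<in>Pow J. \<phi> (card (insert i a)) * haf w (insert i a) * haf w (I - insert i a)) =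
          (\<Sum>j\<in>J. \<Sum>a\<in>Pow (J - {j}).
            w i j * (\<phi> (Suc (card (insert j a))) * haf w (insert j a - {j}) * haf w (J - insert j a)))"
        by (simp add: sum_Pow_in[OF J(2)])
      also have "\<dots> = (\<Sum>j\<in>J. \<Sum>a\<in>Pow (J - {j}).
            w i j * (\<phi> (Suc (Suc (card a))) * haf w a * haf w (J - {j} - a)))"
      proof (intro sum.cong refl)
        fix j a assume a: "a \<in> Pow (J - {j})"
        then have "insert j a - {j} = a" "J - insert j a = J - {j} - a" "j \<notin> a" "finite a"
          using finJ[of a] by auto
        then show "w i j * (\<phi> (Suc (card (insert j a))) * haf w (insert j a - {j}) * haf w (J - insert j a)) =
            w i j * (\<phi> (Suc (Suc (card a))) * haf w a * haf w (J - {j} - a))" by simp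
      qed
      finally show ?thesis by (simp add: sum_distrib_left)
    qed
    \<comment> \<open>The induction hypothesis is used for \<phi> and for \<phi> shifted by two;
      Pascal's rule joins the two sums.\<close>
    have step: "(\<Sum>a\<in>Pow (J - {j}). \<phi> (card a) * haf w a * haf w (J - {j} - a)) +
        (\<Sum>a\<in>Pow (J - {j}). \<phi> (Suc (Suc (card a))) * haf w a * haf w (J - {j} - a)) =
        (\<Sum>j\<le>card I div 2. of_nat (card I div 2 choose j) * \<phi> (2 * j)) * haf w (J - {j})"
      if j: "j \<in> J" for j
    proof -
      define r where "r = card (J - {j}) div 2"
      have "card I = Suc (card J)" using J by (simp add: I)
      then have cI: "card I = Suc (Suc (card (J - {j})))"
        using card_Suc_Diff1[OF J(2) j] by (simp only:)
      then have r: "card I div 2 = Suc r" by (simp add: r_def)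
      have "card (J - {j}) < card I" using cI by simp
      note IH = less.hyps[OF this, folded r_def]
      show ?thesis
        using IH[of \<phi>] IH[of "\<lambda>c. \<phi> (Suc (Suc c))"] J
        unfolding r sum_binomial_pascal by (simp add: distrib_left distrib_right sum.distrib)
    qed
    have "(\<Sum>a\<in>Pow I. \<phi> (card a) * haf w a * haf w (I - a)) =
        (\<Sum>j\<in>J. w i j * ((\<Sum>a\<in>Pow (J - {j}). \<phi> (card a) * haf w a * haf w (J - {j} - a)) +
        (\<Sum>a\<in>Pow (J - {j}). \<phi> (Suc (Suc (card a))) * haf w a * haf w (J - {j} - a))))"
      using out inn sum_Pow_insert[OF J(2,1), of "\<lambda>a. \<phi> (card a) * haf w a * haf w (I - a)"]
      by (simp add: I[symmetric] distrib_left sum.distrib)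
    also have "\<dots> = (\<Sum>j\<in>J. w i j *
        ((\<Sum>j\<le>card I div 2. of_nat (card I div 2 choose j) * \<phi> (2 * j)) * haf w (J - {j})))"
      by (intro sum.cong refl arg_cong2[where f = "(*)"] step)
    also have "\<dots> = (\<Sum>j\<le>card I div 2. of_nat (card I div 2 choose j) * \<phi> (2 * j)) *
        (\<Sum>j\<in>J. w i j * haf w (J - {j}))"
      unfolding sum_distrib_left[of _ _ J] by (simp only: mult.left_commute)
    also have "(\<Sum>j\<in>J. w i j * haf w (J - {j})) = haf w I"
      unfolding I using J sym by (simp add: haf_insert)
    finally show ?thesis .
  qed simp
qed

section \<open>Summing out coordinates\<close>

lemma cnj_haf: "cnj (haf w I) = haf (\<lambda>i j. cnj (w i j)) I"
  by (simp add: haf_def)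

lemma hafnian_map_cnj:
  assumes "dim_col V = dim_row V"
  shows "hafnian (map_mat cnj V) = cnj (hafnian V)"
proof -
  have "hafnian (map_mat cnj V) = haf (\<lambda>i j. map_mat cnj V $$ (i, j)) {..<dim_row V}"
    by (simp add: hafnian_def haf_def)
  also have "\<dots> = haf (\<lambda>i j. cnj (V $$ (i, j))) {..<dim_row V}"
    using assms by (intro haf_cong) auto
  also have "\<dots> = cnj (hafnian V)"
    by (simp add: cnj_haf[symmetric] hafnian_def haf_def)
  finally show ?thesis .
qed

lemma sum_swap3:
  "(\<Sum>v\<in>A. \<Sum>i\<in>B. \<Sum>j\<in>C i. f v i j) = (\<Sum>i\<in>B. \<Sum>j\<in>C i. \<Sum>v\<in>A. f v i j)"
proof -
  have "(\<Sum>v\<in>A. \<Sum>i\<in>B. \<Sum>j\<in>C i. f v i j) = (\<Sum>i\<in>B. \<Sum>v\<in>A. \<Sum>j\<in>C i. f v i j)"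
    by (rule sum.swap)
  also have "\<dots> = (\<Sum>i\<in>B. \<Sum>j\<in>C i. \<Sum>v\<in>A. f v i j)"
    by (intro sum.cong refl, rule sum.swap)
  finally show ?thesis .
qed

text \<open>Symmetry is demanded for all naturals, to meet the hypotheses of the expansions;
  orthonormality of the columns only for indices below \<open>m\<close>.\<close>

locale unitary_kernel =
  fixes m :: nat and K :: "nat \<Rightarrow> nat \<Rightarrow> complex"
  assumes K_sym: "K a b = K b a"
    and K_unitary: "a < m \<Longrightarrow> b < m \<Longrightarrow> (\<Sum>v<m. K v a * cnj (K v b)) = of_bool (a = b)"
begin

abbreviation entry :: "nat list \<Rightarrow> nat \<Rightarrow> nat \<Rightarrow> complex" where
  "entry x i j \<equiv> K (x ! i) (x ! j)"

abbreviation same :: "nat list \<Rightarrow> nat \<Rightarrow> nat \<Rightarrow> complex" where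
  "same x i j \<equiv> of_bool (x ! i = x ! j)"

abbreviation mhaf :: "nat list \<Rightarrow> (nat \<Rightarrow> complex) \<Rightarrow> nat set \<Rightarrow> nat set \<Rightarrow> complex" where
  "mhaf x \<equiv> mixed_haf (same x) (entry x) (\<lambda>i j. cnj (entry x i j))"

text \<open>Position \<open>k\<close> is the point inserted on both sides. Appending does not change
  the entries at old positions, and the new position agrees with itself, so the last term has factor
  1.\<close>

lemma mhaf_snoc:
  assumes x: "set x \<subseteq> {..<m}" and k: "k = length x" and v: "v < m"
  shows "mhaf (x @ [v]) c {..<Suc k} {..<Suc k} =
    (\<Sum>i<k. \<Sum>j<k. K v (x ! i) * cnj (K v (x ! j)) * mhaf x c ({..<k} - {i}) ({..<k} - {j})) +
    (\<Sum>i<k. \<Sum>j\<in>{..<k} - {i}. K v (x ! i) * of_bool (x ! j = v) *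
      mhaf x (\<lambda>\<mu>. c (Suc \<mu>)) ({..<k} - {i} - {j}) {..<k}) +
    (\<Sum>i<k. \<Sum>j\<in>{..<k} - {i}. of_bool (v = x ! i) * cnj (K v (x ! j)) *
      mhaf x (\<lambda>\<mu>. c (Suc \<mu>)) {..<k} ({..<k} - {i} - {j})) +
    (\<Sum>i<k. \<Sum>j<k. of_bool (x ! i = v) * of_bool (v = x ! j) *
      mhaf x (\<lambda>\<mu>. c (Suc (Suc \<mu>))) ({..<k} - {i}) ({..<k} - {j})) +
    mhaf x (\<lambda>\<mu>. c (Suc \<mu>)) {..<k} {..<k}"
proof -
  have nth: "(x @ [v]) ! i = x ! i" if "i < k" for i using that k by (simp add: nth_append)
  have nthk: "(x @ [v]) ! k = v" using k by simp
  have old: "mhaf (x @ [v]) c' P Q = mhaf x c' P Q" if "P \<subseteq> {..<k}" "Q \<subseteq> {..<k}" for c' P Q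
  proof -
    have "finite P" "finite Q" using that finite_subset by blast+
    moreover have "i < k" if "i \<in> P \<or> i \<in> Q" for i
      using \<open>P \<subseteq> {..<k}\<close> \<open>Q \<subseteq> {..<k}\<close> that by blast
    ultimately show ?thesis by (intro mixed_haf_cong) (simp_all add: nth)
  qed
  show ?thesis
    unfolding lessThan_Suc
    by (subst mixed_haf_insert_both)
      (auto simp: K_sym nth nthk old subset_iff intro!: sum.cong arg_cong2[where f = "(+)"])
qed

text \<open>Orthonormality turns the first of the five terms into a sum over cross pairs, with
  weight \<open>\<mu> * c (\<mu> - 1)\<close>. In the next three a Kronecker delta fixes
  \<open>v\<close>. With the last one they multiply \<open>c (Suc \<mu>)\<close> by
  \<open>k - \<mu>\<close>, \<open>k - \<mu>\<close>, \<mu> and \<open>m\<close>, in total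
  \<open>m + 2 * k - \<mu>\<close>.\<close>

lemma sum_mhaf_snoc:
  assumes x: "set x \<subseteq> {..<m}" and k: "k = length x"
  shows "(\<Sum>v<m. mhaf (x @ [v]) c {..<Suc k} {..<Suc k}) =
    mhaf x (\<lambda>\<mu>. of_nat \<mu> * c (\<mu> - 1) + (of_nat m + 2 * of_nat k - of_nat \<mu>) * c (Suc \<mu>)) {..<k} {..<k}"
proof -
  let ?P = "{..<k}"
  let ?c1 = "\<lambda>\<mu>. c (Suc \<mu>)" and ?c2 = "\<lambda>\<mu>. c (Suc (Suc \<mu>))"
  have lt: "x ! i < m" if "i < k" for i using x that k nth_mem by blast
  have delta: "(\<Sum>v<m. of_bool (v = a) * g v) = g a" if "a < m" for a and g :: "nat \<Rightarrow> complex"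
    using that by (simp add: of_bool_def if_distrib[of "\<lambda>b. b * _"] cong: if_cong)
  have t1: "(\<Sum>v<m. \<Sum>i<k. \<Sum>j<k. K v (x ! i) * cnj (K v (x ! j)) * mhaf x c (?P - {i}) (?P - {j})) =
      mhaf x (\<lambda>\<mu>. of_nat \<mu> * c (\<mu> - 1)) ?P ?P" (is "?l = _")
  proof -
    have "?l = (\<Sum>i<k. \<Sum>j<k. (\<Sum>v<m. K v (x ! i) * cnj (K v (x ! j))) * mhaf x c (?P - {i}) (?P - {j}))"
      unfolding sum_distrib_right by (rule sum_swap3)
    also have "\<dots> = (\<Sum>i<k. \<Sum>j<k. same x i j * mhaf x c (?P - {i}) (?P - {j}))"
      by (simp add: K_unitary lt)
    finally show ?thesis by (simp only: mixed_haf_cross[OF finite_lessThan finite_lessThan])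
  qed
  have t2: "(\<Sum>v<m. \<Sum>i<k. \<Sum>j\<in>?P - {i}. K v (x ! i) * of_bool (x ! j = v) * mhaf x ?c1 (?P - {i} - {j}) ?P) =
      mhaf x (\<lambda>\<mu>. (of_nat k - of_nat \<mu>) * ?c1 \<mu>) ?P ?P" (is "?l = _")
  proof -
    have "?l = (\<Sum>i<k. \<Sum>j\<in>?P - {i}. \<Sum>v<m. of_bool (v = x ! j) * (K v (x ! i) * mhaf x ?c1 (?P - {i} - {j}) ?P))"
      by (rule trans[OF sum_swap3], intro sum.cong refl) (auto simp: of_bool_def)
    also have "\<dots> = (\<Sum>i<k. \<Sum>j\<in>?P - {i}. entry x i j * mhaf x ?c1 (?P - {i} - {j}) ?P)"
      using delta lt K_sym by (intro sum.cong refl) auto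
    also have "\<dots> = mhaf x (\<lambda>\<mu>. (of_nat (card ?P) - of_nat \<mu>) * ?c1 \<mu>) ?P ?P"
      by (rule mixed_haf_pairs_left) (auto simp: K_sym)
    finally show ?thesis by simp
  qed
  have t3: "(\<Sum>v<m. \<Sum>i<k. \<Sum>j\<in>?P - {i}. of_bool (v = x ! i) * cnj (K v (x ! j)) * mhaf x ?c1 ?P (?P - {i} - {j})) =
      mhaf x (\<lambda>\<mu>. (of_nat k - of_nat \<mu>) * ?c1 \<mu>) ?P ?P" (is "?l = _")
  proof -
    have "?l = (\<Sum>i<k. \<Sum>j\<in>?P - {i}. \<Sum>v<m. of_bool (v = x ! i) * (cnj (K v (x ! j)) * mhaf x ?c1 ?P (?P - {i} - {j})))"
      unfolding mult.assoc by (rule sum_swap3)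
    also have "\<dots> = (\<Sum>i<k. \<Sum>j\<in>?P - {i}. cnj (entry x i j) * mhaf x ?c1 ?P (?P - {i} - {j}))"
      using delta lt by (intro sum.cong refl) auto
    also have "\<dots> = mhaf x (\<lambda>\<mu>. (of_nat (card ?P) - of_nat \<mu>) * ?c1 \<mu>) ?P ?P"
      by (rule mixed_haf_pairs_right) (auto simp: K_sym)
    finally show ?thesis by simp
  qed
  have t4: "(\<Sum>v<m. \<Sum>i<k. \<Sum>j<k. of_bool (x ! i = v) * of_bool (v = x ! j) * mhaf x ?c2 (?P - {i}) (?P - {j})) =
      mhaf x (\<lambda>\<mu>. of_nat \<mu> * ?c1 \<mu>) ?P ?P" (is "?l = _")
  proof -
    have "?l = (\<Sum>i<k. \<Sum>j<k. \<Sum>v<m. of_bool (v = x ! j) * (of_bool (x ! i = v) * mhaf x ?c2 (?P - {i}) (?P - {j})))"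
      by (rule trans[OF sum_swap3], intro sum.cong refl) (auto simp: of_bool_def)
    also have "\<dots> = (\<Sum>i<k. \<Sum>j<k. same x i j * mhaf x ?c2 (?P - {i}) (?P - {j}))"
      using delta lt by (intro sum.cong refl) auto
    also have "\<dots> = mhaf x (\<lambda>\<mu>. of_nat \<mu> * ?c2 (\<mu> - 1)) ?P ?P"
      by (simp only: mixed_haf_cross[OF finite_lessThan finite_lessThan])
    also have "(\<lambda>\<mu>. of_nat \<mu> * ?c2 (\<mu> - 1)) = (\<lambda>\<mu>. of_nat \<mu> * ?c1 \<mu>)"
      by (rule ext, case_tac \<mu>) auto
    finally show ?thesis .
  qed
  have t5: "(\<Sum>v<m. mhaf x ?c1 ?P ?P) = mhaf x (\<lambda>\<mu>. of_nat m * ?c1 \<mu>) ?P ?P"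
    by (simp add: mixed_haf_scale)
  have "(\<Sum>v<m. mhaf (x @ [v]) c {..<Suc k} {..<Suc k}) =
    mhaf x (\<lambda>\<mu>. of_nat \<mu> * c (\<mu> - 1)) ?P ?P + mhaf x (\<lambda>\<mu>. (of_nat k - of_nat \<mu>) * ?c1 \<mu>) ?P ?P +
    mhaf x (\<lambda>\<mu>. (of_nat k - of_nat \<mu>) * ?c1 \<mu>) ?P ?P + mhaf x (\<lambda>\<mu>. of_nat \<mu> * ?c1 \<mu>) ?P ?P +
    mhaf x (\<lambda>\<mu>. of_nat m * ?c1 \<mu>) ?P ?P"
    by (rule trans[OF sum.cong[OF refl mhaf_snoc[OF x k]]])
      (simp_all only: lessThan_iff sum.distrib t1 t2 t3 t4 t5)
  also have "\<dots> = mhaf x (\<lambda>\<mu>. of_nat \<mu> * c (\<mu> - 1) + (of_nat k - of_nat \<mu>) * ?c1 \<mu> +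
      (of_nat k - of_nat \<mu>) * ?c1 \<mu> + of_nat \<mu> * ?c1 \<mu> + of_nat m * ?c1 \<mu>) ?P ?P"
    by (simp only: mixed_haf_add)
  also have "(\<lambda>\<mu>. of_nat \<mu> * c (\<mu> - 1) + (of_nat k - of_nat \<mu>) * ?c1 \<mu> +
      (of_nat k - of_nat \<mu>) * ?c1 \<mu> + of_nat \<mu> * ?c1 \<mu> + of_nat m * ?c1 \<mu>) =
    (\<lambda>\<mu>. of_nat \<mu> * c (\<mu> - 1) + (of_nat m + 2 * of_nat k - of_nat \<mu>) * c (Suc \<mu>))"
    by (simp add: algebra_simps)
  finally show ?thesis .
qed

section \<open>Summing out all remaining coordinates\<close>

lemma sum_tuples_Suc:
  "(\<Sum>y\<in>tuples m (Suc l). g y) = (\<Sum>v<m. \<Sum>y\<in>tuples m l. g (v # y))"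
proof -
  have "(\<Sum>y\<in>tuples m (Suc l). g y) = (\<Sum>(v, y)\<in>{..<m} \<times> tuples m l. g (v # y))"
    by (rule sum.reindex_bij_witness[of _ "\<lambda>(v, y). v # y" "\<lambda>y. (hd y, tl y)"])
      (auto simp: tuples_def length_Suc_conv)
  then show ?thesis by (simp add: sum.cartesian_product)
qed

text \<open>Induction on \<open>l\<close> for all \<open>x\<close>: the first summed coordinate is
  appended to \<open>x\<close>. For \<open>l = 0\<close> the weight forces \<open>A\<close> to be
  empty and the permanent then forces \<open>B\<close> to be, leaving a Hafnian times its
  conjugate.\<close>

lemma sum_cmod_haf:
  assumes "set x \<subseteq> {..<m}" and "k = length x"
  shows "(\<Sum>y\<in>tuples m l. complex_of_real ((cmod (haf (entry (x @ y)) {..<k + l}))\<^sup>2)) =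
    mhaf x (\<lambda>\<mu>. complex_of_real (haf_coeff m l k \<mu>)) {..<k} {..<k}"
  using assms
proof (induction l arbitrary: x k)
  case 0
  let ?P = "{..<k}"
  have "mhaf x (\<lambda>\<mu>. complex_of_real (haf_coeff m 0 k \<mu>)) ?P ?P =
    (\<Sum>A\<in>Pow ?P. if A = {} then \<Sum>B\<in>Pow ?P. if B = {} then
      haf (entry x) ?P * haf (\<lambda>i j. cnj (entry x i j)) ?P else 0 else 0)"
    unfolding mixed_haf_def
  proof (intro sum.cong refl)
    fix A assume A: "A \<in> Pow ?P"
    then have "finite A" using finite_subset by auto
    then show "(\<Sum>B\<in>Pow ?P. complex_of_real (haf_coeff m 0 k (card A)) * per (same x) A B *
        haf (entry x) (?P - A) * haf (\<lambda>i j. cnj (entry x i j)) (?P - B)) =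
      (if A = {} then \<Sum>B\<in>Pow ?P. if B = {} then
        haf (entry x) ?P * haf (\<lambda>i j. cnj (entry x i j)) ?P else 0 else 0)"
    proof (cases "A = {}")
      case True
      have "(\<Sum>B\<in>Pow ?P. complex_of_real (haf_coeff m 0 k (card {})) * per (same x) {} B *
          haf (entry x) (?P - {}) * haf (\<lambda>i j. cnj (entry x i j)) (?P - B)) =
        (\<Sum>B\<in>Pow ?P. if B = {} then haf (entry x) ?P * haf (\<lambda>i j. cnj (entry x i j)) ?P else 0)"
        by (intro sum.cong refl) (simp add: haf_coeff_0 per_empty)
      then show ?thesis unfolding True by simp
    qed (simp add: haf_coeff_0)
  qed
  also have "\<dots> = complex_of_real ((cmod (haf (entry x) ?P))\<^sup>2)"
    unfolding complex_norm_square cnj_haf by simp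
  finally have "mhaf x (\<lambda>\<mu>. complex_of_real (haf_coeff m 0 k \<mu>)) ?P ?P =
      complex_of_real ((cmod (haf (entry x) ?P))\<^sup>2)" .
  moreover have "tuples m 0 = {[]}" by (auto simp: tuples_def)
  ultimately show ?case by simp
next
  case (Suc l)
  have "(\<Sum>y\<in>tuples m (Suc l). complex_of_real ((cmod (haf (entry (x @ y)) {..<k + Suc l}))\<^sup>2)) =
    (\<Sum>v<m. \<Sum>y\<in>tuples m l. complex_of_real ((cmod (haf (entry ((x @ [v]) @ y)) {..<Suc k + l}))\<^sup>2))"
    by (simp add: sum_tuples_Suc)
  also have "\<dots> = (\<Sum>v<m. mhaf (x @ [v]) (\<lambda>\<mu>. complex_of_real (haf_coeff m l (Suc k) \<mu>)) {..<Suc k} {..<Suc k})"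
    using Suc.prems by (intro sum.cong refl Suc.IH) auto
  also have "\<dots> = mhaf x (\<lambda>\<mu>. complex_of_real (haf_coeff m (Suc l) k \<mu>)) {..<k} {..<k}"
    by (simp only: sum_mhaf_snoc[OF Suc.prems] haf_coeff_Suc) simp
  finally show ?case .
qed

end

text \<open>Cutting the entries off to 0 outside the matrix makes symmetry hold for all naturals.
  For orthonormality both entries of \<open>W\<close> are expanded: the columns of \<open>U\<close>
  collapse the sum over \<open>v\<close>, the rows of \<open>U\<close> the sum that remains.\<close>

lemma unitary_kernel_transpose:
  assumes U: "unitary_mat m U" and W: "W = U * transpose_mat U"
  shows "unitary_kernel m (\<lambda>a b. if a < m \<and> b < m then W $$ (a, b) else 0)"
proof
  have dim: "dim_row U = m" "dim_col U = m" using U by (auto simp: unitary_mat_def)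
  have Went: "W $$ (a, b) = (\<Sum>p<m. U $$ (a, p) * U $$ (b, p))" if "a < m" "b < m" for a b
    using that dim by (simp add: W scalar_prod_def lessThan_atLeast0)
  show "(if a < m \<and> b < m then W $$ (a, b) else 0) = (if b < m \<and> a < m then W $$ (b, a) else 0)" for a b
    by (auto simp: Went mult.commute)
  have rows: "(\<Sum>p<m. U $$ (a, p) * cnj (U $$ (b, p))) = of_bool (a = b)" if "a < m" "b < m" for a b
  proof -
    have *: "(U * mat_adjoint U) $$ (a, b) = (\<Sum>p<m. U $$ (a, p) * cnj (U $$ (b, p)))"
      using that dim by (simp add: mat_adjoint_def scalar_prod_def lessThan_atLeast0 mat_of_rows_def)
    show ?thesis unfolding *[symmetric] using U that by (auto simp: unitary_mat_def)
  qed
  have cols: "(\<Sum>v<m. U $$ (v, p) * cnj (U $$ (v, q))) = of_bool (p = q)" if "p < m" "q < m" for p q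
  proof -
    have *: "(mat_adjoint U * U) $$ (q, p) = (\<Sum>v<m. U $$ (v, p) * cnj (U $$ (v, q)))"
      using that dim by (simp add: mat_adjoint_def scalar_prod_def lessThan_atLeast0 mat_of_rows_def mult.commute)
    show ?thesis unfolding *[symmetric] using U that by (auto simp: unitary_mat_def)
  qed
  show "(\<Sum>v<m. (if v < m \<and> a < m then W $$ (v, a) else 0) *
      cnj (if v < m \<and> b < m then W $$ (v, b) else 0)) = of_bool (a = b)" if "a < m" "b < m" for a b
  proof -
    have "(\<Sum>v<m. (if v < m \<and> a < m then W $$ (v, a) else 0) *
        cnj (if v < m \<and> b < m then W $$ (v, b) else 0)) =
      (\<Sum>v<m. \<Sum>p<m. \<Sum>q<m. U $$ (a, p) * cnj (U $$ (b, q)) * (U $$ (v, p) * cnj (U $$ (v, q))))"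
      using that by (intro sum.cong refl) (simp add: Went sum_product mult_ac)
    also have "\<dots> = (\<Sum>p<m. \<Sum>q<m. U $$ (a, p) * cnj (U $$ (b, q)) * (\<Sum>v<m. U $$ (v, p) * cnj (U $$ (v, q))))"
      unfolding sum_distrib_left by (rule sum_swap3)
    also have "\<dots> = (\<Sum>p<m. U $$ (a, p) * cnj (U $$ (b, p)))"
      by (simp add: cols of_bool_def if_distrib cong: if_cong)
    finally show ?thesis using rows[OF that] by simp
  qed
qed

section \<open>Regrouping the marginal formula\<close>

text \<open>Sorting subsets by size loses nothing if the sizes \<open>g j\<close> cover all subsets
  with a nonzero summand. It is applied with \<open>g\<close> doubling for \<open>a\<close> and
  \<open>a'\<close>, and with \<open>g\<close> the identity for \<open>A\<close>.\<close>

lemma sum_subsets_of_card: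
  assumes "finite X" "finite J" "inj_on g J"
    and nz: "\<And>a. a \<subseteq> X \<Longrightarrow> h a \<noteq> 0 \<Longrightarrow> card a \<in> g ` J"
  shows "(\<Sum>j\<in>J. \<Sum>a\<in>subsets_of_card X (g j). h a) = (\<Sum>a\<in>Pow X. h a)"
proof -
  have fin: "finite (subsets_of_card X r)" for r
    using assms(1) by (auto simp: subsets_of_card_def)
  have "(\<Sum>j\<in>J. \<Sum>a\<in>subsets_of_card X (g j). h a) = (\<Sum>a\<in>(\<Union>j\<in>J. subsets_of_card X (g j)). h a)"
    using assms fin by (intro sum.UNION_disjoint[symmetric]) (auto simp: subsets_of_card_def inj_on_def)
  also have "\<dots> = (\<Sum>a\<in>Pow X. h a)"
    using assms by (intro sum.mono_neutral_left) (auto simp: subsets_of_card_def)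
  finally show ?thesis .
qed

text \<open>The coefficient \<open>F\<close> depends on \<open>j\<^sub>1, j\<^sub>2\<close> only through their sum \<open>s\<close>. Unlike \<open>F_coeff\<close>, this
  version vanishes below the lower bound on \<open>\<mu>\<close>, so the summation ranges may be dropped.\<close>

definition F_zbinom :: "nat \<Rightarrow> nat \<Rightarrow> nat \<Rightarrow> nat \<Rightarrow> nat \<Rightarrow> real" where
  "F_zbinom m n k \<mu> s = fact (n - k) / norm_f m n *
     zbinom ((real n - real k + real \<mu> + real m) / 2 - 1) ((int n - 3 * int k + int \<mu>) div 2 + int s)"

text \<open>The parity condition on \<mu> makes the difference of the indices an integer and the
  lower bound makes it non-negative, so the rounding in \<open>binom_codeg\<close> is exact.\<close>

lemma F_coeff_eq:
  assumes "even n" and \<mu>: "\<mu> \<in> mu_range n k j1 j2"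
  shows "F_coeff m n k \<mu> j1 j2 = F_zbinom m n k \<mu> (j1 + j2)"
proof -
  have "\<mu> mod 2 = k mod 2" using \<mu> by (simp add: mu_range_def)
  then have "even (int \<mu> - int k)" by presburger
  then have "even (int n - 3 * int k + int \<mu>)" using assms(1) by simp
  then obtain t where t: "int n - 3 * int k + int \<mu> = 2 * t" by (rule evenE)
  then have tr: "real n - 3 * real k + real \<mu> = 2 * real_of_int t"
    using arg_cong[OF t, of real_of_int] by simp
  have "t + int (j1 + j2) \<ge> 0" using \<mu> t by (simp add: mu_range_def)
  moreover have "(real n - real k + real \<mu> + real m) / 2 - 1 -
      (real k - real j1 - real j2 + real m / 2 - 1) = of_int (t + int (j1 + j2))"
    using tr by (simp add: field_simps)
  ultimately show ?thesis
    unfolding F_coeff_def F_zbinom_def binom_codeg_def t by (simp only: floor_of_int) (simp add: zbinom_def)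
qed

text \<open>Two applications of Vandermonde raise the upper index by
  \<open>2 * r = k - \<mu>\<close>, which turns it into that of \<open>haf_coeff\<close>. The lower
  index at \<open>j1 = j2 = 0\<close> is \<open>t - 2 * r\<close>, one shift by \<open>r\<close> for
  each sum.\<close>

lemma F_zbinom_vandermonde:
  assumes "k \<le> n" and r: "k = \<mu> + 2 * r" and "even n"
  shows "(\<Sum>j1\<le>r. real (r choose j1) * (\<Sum>j2\<le>r. real (r choose j2) * F_zbinom m n k \<mu> (j1 + j2))) =
    haf_coeff m (n - k) k \<mu> / norm_f m n"
proof -
  define N where "N = (real n - real k + real \<mu> + real m) / 2 - 1"
  have "even (int (n - k) - int \<mu>)" using assms by simp
  then obtain t where t: "int (n - k) - int \<mu> = 2 * t" by (rule evenE)
  have "int n - 3 * int k + int \<mu> = 2 * (t - 2 * int r)" using t assms(1) r by simp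
  then have d: "(int n - 3 * int k + int \<mu>) div 2 = t - 2 * int r" by simp
  have F: "F_zbinom m n k \<mu> (j1 + j2) =
      fact (n - k) / norm_f m n * zbinom N (t + int j1 - int r + int j2 - int r)" for j1 j2
    unfolding F_zbinom_def N_def d by (simp add: algebra_simps)
  have "(\<Sum>j1\<le>r. real (r choose j1) * (\<Sum>j2\<le>r. real (r choose j2) * F_zbinom m n k \<mu> (j1 + j2))) =
      fact (n - k) / norm_f m n * (\<Sum>j1\<le>r. real (r choose j1) *
        (\<Sum>j2\<le>r. real (r choose j2) * zbinom N (t + int j1 - int r + int j2 - int r)))"
    unfolding F by (simp add: sum_distrib_left mult_ac)
  also have "\<dots> = fact (n - k) / norm_f m n * zbinom (N + real r + real r) t"
    by (simp only: zbinom_vandermonde)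
  also have "N + real r + real r = real k + (real m + real (n - k) - real \<mu>) / 2 - 1"
    using assms(1) r by (simp add: N_def field_simps of_nat_diff)
  finally show ?thesis using t by (simp add: haf_coeff_def)
qed

text \<open>The non-negative lower index gives
  \<open>3 * k \<le> \<mu> + n + 2 * j1 + 2 * j2\<close>. Inserting
  \<open>\<mu> + 2 * j2 \<le> k\<close> yields the lower bound on \<open>j1\<close>, and
  symmetrically for \<open>j2\<close>. Here \<open>p\<close> is the number of positions outside
  \<open>a\<close> and \<open>A\<close>.\<close>

lemma index_ranges:
  assumes t: "int n - 3 * int k + int \<mu> = 2 * t" and t0: "t + int (j1 + j2) \<ge> 0"
    and j1: "p + \<mu> + 2 * j1 = k" and j2: "\<mu> + 2 * j2 \<le> k" and "\<mu> mod 2 = k mod 2"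
  shows "\<mu> \<in> mu_range n k j1 j2" "j1 \<in> j_range n k" "j2 \<in> j_range n k"
proof -
  have low: "3 * k \<le> \<mu> + n + 2 * j1 + 2 * j2" using t t0 by presburger
  have "3 * int k - 2 * (int j1 + int j2) - int n \<le> int \<mu>" using low by presburger
  moreover have "int \<mu> \<le> int k - 2 * int j1" "int \<mu> \<le> int k - 2 * int j2"
    using j1 j2 by presburger+
  ultimately show "\<mu> \<in> mu_range n k j1 j2"
    using assms(5) by (simp add: mu_range_def max_def)
  have in_range: "j \<in> j_range n k" if "2 * k \<le> 2 * j + n" "2 * j \<le> k" for j
  proof -
    have "real (2 * k) \<le> real (2 * j + n)" "real (2 * j) \<le> real k"
      using that by (simp_all only: of_nat_le_iff)
    then show ?thesis by (simp add: j_range_def)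
  qed
  show "j1 \<in> j_range n k" "j2 \<in> j_range n k"
    by (rule in_range; use low j1 j2 in presburger)+
qed

theorem theorem1:
  fixes m n k :: nat and U W :: "complex mat" and x :: "nat list"
  assumes "m \<ge> 1" and "n \<ge> 2" and "even n" and "1 \<le> k" and "k \<le> n"
    and "unitary_mat m U" and "W = U * transpose_mat U"
    and "x \<in> tuples m k"
  shows "complex_of_real (q_marginal m W n k x) =
    (\<Sum>j1\<in>j_range n k. \<Sum>j2\<in>j_range n k.
     \<Sum>a\<in>subsets_of_card {..<k} (2 * j1). \<Sum>a'\<in>subsets_of_card {..<k} (2 * j2).
       hafnian (R_mat W x a) * hafnian (R_conj_mat W x a') *
       (\<Sum>\<mu>\<in>mu_range n k j1 j2.
          complex_of_real (F_coeff m n k \<mu> j1 j2) *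
          (\<Sum>A\<in>subsets_of_card ({..<k} - a) \<mu>. \<Sum>B\<in>subsets_of_card ({..<k} - a') \<mu>.
             permanent (S_mat x A B) *
             hafnian (R_mat W x ({..<k} - (a \<union> A))) *
             hafnian (R_conj_mat W x ({..<k} - (a' \<union> B))))))"
    (is "_ = ?rhs")
proof -
  define K where "K = (\<lambda>a b. if a < m \<and> b < m then W $$ (a, b) else 0)"
  interpret unitary_kernel m K
    unfolding K_def using assms by (intro unitary_kernel_transpose)
  have k: "k = length x" and x: "set x \<subseteq> {..<m}" using assms by (auto simp: tuples_def)
  define P where "P = {..<k}"
  define w where "w = entry x"
  define w' where "w' = (\<lambda>i j. cnj (entry x i j))"
  have w_sym: "w i j = w j i" "w' i j = w' j i" for i j by (simp_all add: w_def w'_def K_sym)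
  have finP: "finite P" and cardP: "card P = k" by (simp_all add: P_def)
  have entry: "W $$ (y ! i, y ! j) = entry y i j"
    if "set y \<subseteq> {..<m}" "i < length y" "j < length y" for y i j
  proof -
    have "y ! i < m" "y ! j < m" using that by (meson nth_mem subsetD lessThan_iff)+
    then show ?thesis by (simp add: K_def)
  qed
  have haf_tuple: "hafnian (tuple_mat W y) = haf (entry y) {..<length y}" if "set y \<subseteq> {..<m}" for y
    unfolding tuple_mat_def hafnian_mat using that entry by (intro haf_cong) auto
  have haf_R: "hafnian (R_mat W x a) = haf w a" if "a \<subseteq> P" for a
    unfolding R_mat_def
    by (rule hafnian_submatrix[where r = k])
      (use that entry[OF x] w_sym in \<open>auto simp: P_def w_def k tuple_mat_def\<close>)
  have haf_R': "hafnian (R_conj_mat W x a) = haf w' a" if "a \<subseteq> P" for a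
    using haf_R[OF that]
    by (simp add: R_conj_mat_def hafnian_map_cnj R_mat_def dim_submatrix tuple_mat_def cnj_haf w_def w'_def)

  \<comment> \<open>The marginal as a weighted sum over pairs of subsets\<close>
  have "complex_of_real (q_marginal m W n k x) = 1 / complex_of_real (norm_f m n) *
      (\<Sum>y\<in>tuples m (n - k). complex_of_real ((cmod (haf (entry (x @ y)) {..<k + (n - k)}))\<^sup>2))"
    unfolding q_marginal_def q_prob_def
    by (simp add: sum_distrib_left haf_tuple tuples_def k x del: of_real_power)
  also have "\<dots> = 1 / complex_of_real (norm_f m n) *
      mixed_haf (same x) w w' (\<lambda>\<mu>. complex_of_real (haf_coeff m (n - k) k \<mu>)) P P"
    by (simp only: sum_cmod_haf[OF x k] P_def w_def w'_def)
  also have "\<dots> = (\<Sum>A\<in>Pow P. \<Sum>B\<in>Pow P. complex_of_real (haf_coeff m (n - k) k (card A) / norm_f m n) *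
      per (same x) A B * haf w (P - A) * haf w' (P - B))"
    by (simp add: mixed_haf_def sum_distrib_left mult_ac)
  finally have lhs: "complex_of_real (q_marginal m W n k x) = \<dots>" .

  \<comment> \<open>Nonvanishing terms of the right-hand side\<close>
  define \<Phi> where "\<Phi> = (\<lambda>\<mu> s. complex_of_real (F_zbinom m n k \<mu> s))"
  \<comment> \<open>The summand with all indices read off from the sets. Rounding in
    \<open>card a div 2\<close> is harmless, since the Hafnian over a set of odd size is 0.\<close>
  define G where "G = (\<lambda>a a' A B. \<Phi> (card A) (card a div 2 + card a' div 2) * per (same x) A B *
      (haf w a * haf w (P - A - a)) * (haf w' a' * haf w' (P - B - a')))"
  \<comment> \<open>Odd Hafnians, permanents of unequal sizes and negative lower indices all vanish,
    so a nonzero term satisfies every range condition. The ranges can therefore be dropped.\<close>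
  have G_nz: "even (card a) \<and> even (card a') \<and> card A = card B \<and>
      card a div 2 \<in> j_range n k \<and> card a' div 2 \<in> j_range n k \<and>
      card A \<in> mu_range n k (card a div 2) (card a' div 2)"
    if sub: "a \<subseteq> P" "a' \<subseteq> P" "A \<subseteq> P - a" "B \<subseteq> P - a'" and nz: "G a a' A B \<noteq> 0" for a a' A B
  proof -
    have fin: "finite a" "finite a'" "finite A" "finite B"
      using sub finP by (meson finite_subset finite_Diff)+
    have card_rest: "card (P - C - c) + card C + card c = k" if "c \<subseteq> P" "C \<subseteq> P - c" for c C
    proof -
      have "finite c" "finite C" using that finP by (meson finite_subset finite_Diff)+
      moreover have "P - C - c = P - (c \<union> C)" "c \<inter> C = {}" "c \<union> C \<subseteq> P" using that by auto
      ultimately show ?thesis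
        using card_mono[OF finP, of "c \<union> C"] by (simp add: card_Diff_subset card_Un_disjoint cardP)
    qed
    have eqAB: "card A = card B"
      using nz per_card_neq by (auto simp: G_def)
    have ev: "even (card a)" "even (card a')" "even (card (P - A - a))"
    proof -
      have "haf w a \<noteq> 0" "haf w' a' \<noteq> 0" "haf w (P - A - a) \<noteq> 0" using nz by (simp_all add: G_def)
      then show "even (card a)" "even (card a')" "even (card (P - A - a))"
        using haf_odd fin finP by (meson finite_Diff)+
    qed
    obtain j1 where j1: "card a = 2 * j1" using ev(1) by (rule evenE)
    obtain j2 where j2: "card a' = 2 * j2" using ev(2) by (rule evenE)
    note j = j1 j2
    have 1: "card (P - A - a) + card A + 2 * j1 = k" using card_rest[of a A] sub j by simp
    have 2: "card A + 2 * j2 \<le> k" using card_rest[of a' B] sub j eqAB by simp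
    have par: "card A mod 2 = k mod 2" using 1 ev(3) by presburger
    have "even (int n - 3 * int k + int (card A))" using par assms(3) by presburger
    then obtain t where t: "int n - 3 * int k + int (card A) = 2 * t" by (rule evenE)
    have t0: "t + int (j1 + j2) \<ge> 0"
      using nz t j zbinom_neg[of "t + int (j1 + j2)"]
      by (force simp: G_def \<Phi>_def F_zbinom_def)
    show ?thesis using index_ranges[OF t t0 1 2 par] ev j eqAB by simp
  qed
  have fin_j: "finite (j_range n k)"
    by (rule finite_subset[of _ "{..k}"]) (auto simp: j_range_def)
  have fin_mu: "finite (mu_range n k j1 j2)" for j1 j2
    by (rule finite_subset[of _ "{..k}"]) (auto simp: mu_range_def)
  define H where "H = (\<lambda>a a'. \<Sum>A\<in>Pow (P - a). \<Sum>B\<in>Pow (P - a'). G a a' A B)"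
  have H_nz: "card a \<in> (*) 2 ` j_range n k \<and> card a' \<in> (*) 2 ` j_range n k"
    if "a \<subseteq> P" "a' \<subseteq> P" "H a a' \<noteq> 0" for a a'
  proof -
    obtain A where A: "A \<in> Pow (P - a)" "(\<Sum>B\<in>Pow (P - a'). G a a' A B) \<noteq> 0"
      using \<open>H a a' \<noteq> 0\<close> unfolding H_def by (rule sum.not_neutral_contains_not_neutral)
    obtain B where B: "B \<in> Pow (P - a')" "G a a' A B \<noteq> 0"
      using A(2) by (rule sum.not_neutral_contains_not_neutral)
    have "even (card a)" "even (card a')" "card a div 2 \<in> j_range n k" "card a' div 2 \<in> j_range n k"
      using G_nz[of a a' A B] that A B by auto
    moreover have "c \<in> (*) 2 ` j_range n k" if "even c" "c div 2 \<in> j_range n k" for c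
      using that by (intro image_eqI[of _ _ "c div 2"]) auto
    ultimately show ?thesis by blast
  qed
  have summand: "hafnian (R_mat W x a) * hafnian (R_conj_mat W x a') *
      (\<Sum>\<mu>\<in>mu_range n k j1 j2. complex_of_real (F_coeff m n k \<mu> j1 j2) *
        (\<Sum>A\<in>subsets_of_card ({..<k} - a) \<mu>. \<Sum>B\<in>subsets_of_card ({..<k} - a') \<mu>.
          permanent (S_mat x A B) * hafnian (R_mat W x ({..<k} - (a \<union> A))) *
          hafnian (R_conj_mat W x ({..<k} - (a' \<union> B))))) = H a a'" (is "?t = _")
    if a: "a \<in> subsets_of_card P (2 * j1)" and a': "a' \<in> subsets_of_card P (2 * j2)" for j1 j2 a a'
  proof -
    have sub: "a \<subseteq> P" "a' \<subseteq> P" and j: "card a div 2 = j1" "card a' div 2 = j2"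
      using a a' by (auto simp: subsets_of_card_def)
    have "?t = (\<Sum>\<mu>\<in>mu_range n k j1 j2. \<Sum>A\<in>subsets_of_card (P - a) \<mu>.
        \<Sum>B\<in>subsets_of_card (P - a') \<mu>. G a a' A B)"
      unfolding sum_distrib_left P_def[symmetric]
    proof (intro sum.cong refl)
      fix \<mu> A B
      assume \<mu>: "\<mu> \<in> mu_range n k j1 j2" and "A \<in> subsets_of_card (P - a) \<mu>" "B \<in> subsets_of_card (P - a') \<mu>"
      then have AB: "A \<subseteq> P" "B \<subseteq> P" "card A = \<mu>" "card B = \<mu>" by (auto simp: subsets_of_card_def)
      have "permanent (S_mat x A B) = per (same x) A B"
        using AB by (intro permanent_S_mat) (auto simp: P_def k)
      moreover have "P - (a \<union> A) = P - A - a" "P - (a' \<union> B) = P - B - a'" by auto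
      moreover have "P - A - a \<subseteq> P" "P - B - a' \<subseteq> P" by auto
      ultimately show "hafnian (R_mat W x a) * hafnian (R_conj_mat W x a') *
          (complex_of_real (F_coeff m n k \<mu> j1 j2) * (permanent (S_mat x A B) *
            hafnian (R_mat W x (P - (a \<union> A))) * hafnian (R_conj_mat W x (P - (a' \<union> B))))) = G a a' A B"
        using sub j AB F_coeff_eq[OF assms(3) \<mu>]
        by (simp only: haf_R haf_R' G_def \<Phi>_def) (simp add: mult_ac)
    qed
    also have "\<dots> = (\<Sum>\<mu>\<in>mu_range n k j1 j2. \<Sum>A\<in>subsets_of_card (P - a) \<mu>.
        \<Sum>B\<in>Pow (P - a'). G a a' A B)"
    \<comment> \<open>Sets \<open>B\<close> whose size differs from that of \<open>A\<close>
      contribute 0.\<close>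
    proof (intro sum.cong[OF refl] sum.mono_neutral_left)
      fix \<mu> A assume "A \<in> subsets_of_card (P - a) \<mu>"
      then show "\<forall>B\<in>Pow (P - a') - subsets_of_card (P - a') \<mu>. G a a' A B = 0"
        using G_nz[OF sub] by (auto simp: subsets_of_card_def)
    qed (use finP in \<open>auto simp: subsets_of_card_def\<close>)
    also have "\<dots> = H a a'"
      unfolding H_def
    proof (rule sum_subsets_of_card[where g = "\<lambda>\<mu>. \<mu>"])
      fix A assume A: "A \<subseteq> P - a" and nz: "(\<Sum>B\<in>Pow (P - a'). G a a' A B) \<noteq> 0"
      obtain B where "B \<in> Pow (P - a')" "G a a' A B \<noteq> 0"
        using nz by (rule sum.not_neutral_contains_not_neutral)
      then have "card A \<in> mu_range n k (card a div 2) (card a' div 2)"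
        using G_nz[OF sub A] by blast
      then show "card A \<in> (\<lambda>\<mu>. \<mu>) ` mu_range n k j1 j2"
        unfolding j by simp
    qed (use finP fin_mu in auto)
    finally show ?thesis .
  qed

  \<comment> \<open>Regrouping the right-hand side by the endpoints of cross pairs\<close>
  have "?rhs = (\<Sum>j1\<in>j_range n k. \<Sum>j2\<in>j_range n k.
      \<Sum>a\<in>subsets_of_card P (2 * j1). \<Sum>a'\<in>subsets_of_card P (2 * j2). H a a')"
    unfolding P_def[symmetric] by (intro sum.cong refl summand[unfolded P_def[symmetric]])
  also have "\<dots> = (\<Sum>j1\<in>j_range n k. \<Sum>a\<in>subsets_of_card P (2 * j1).
      \<Sum>j2\<in>j_range n k. \<Sum>a'\<in>subsets_of_card P (2 * j2). H a a')"
    by (rule sum.cong[OF refl], rule sum.swap)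
  also have "\<dots> = (\<Sum>j1\<in>j_range n k. \<Sum>a\<in>subsets_of_card P (2 * j1). \<Sum>a'\<in>Pow P. H a a')"
  proof (intro sum.cong refl sum_subsets_of_card finP fin_j)
    fix j1 a a' assume "a \<in> subsets_of_card P (2 * j1)" "a' \<subseteq> P" "H a a' \<noteq> 0"
    then show "card a' \<in> (*) 2 ` j_range n k"
      using H_nz by (auto simp: subsets_of_card_def)
  qed (auto simp: inj_on_def)
  also have "\<dots> = (\<Sum>a\<in>Pow P. \<Sum>a'\<in>Pow P. H a a')"
  proof (intro sum_subsets_of_card finP fin_j)
    fix a assume a: "a \<subseteq> P" and nz: "(\<Sum>a'\<in>Pow P. H a a') \<noteq> 0"
    obtain a' where "a' \<in> Pow P" "H a a' \<noteq> 0"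
      using nz by (rule sum.not_neutral_contains_not_neutral)
    then show "card a \<in> (*) 2 ` j_range n k" using H_nz[OF a] by auto
  qed (auto simp: inj_on_def)
  \<comment> \<open>The sums are now over all disjoint pairs of subsets. Interchanges bring
    \<open>A\<close> and \<open>B\<close> outside, with \<open>a\<close> and \<open>a'\<close>
    ranging over subsets of their complements.\<close>
  also have "\<dots> = (\<Sum>a\<in>Pow P. \<Sum>A\<in>Pow (P - a). \<Sum>a'\<in>Pow P. \<Sum>B\<in>Pow (P - a'). G a a' A B)"
    unfolding H_def by (rule sum.cong[OF refl], rule sum.swap)
  also have "\<dots> = (\<Sum>A\<in>Pow P. \<Sum>a\<in>Pow (P - A). \<Sum>a'\<in>Pow P. \<Sum>B\<in>Pow (P - a'). G a a' A B)"
    by (rule sum_Pow_disjoint_swap[OF finP])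
  also have "\<dots> = (\<Sum>A\<in>Pow P. \<Sum>a\<in>Pow (P - A). \<Sum>B\<in>Pow P. \<Sum>a'\<in>Pow (P - B). G a a' A B)"
    by (rule sum.cong[OF refl], rule sum.cong[OF refl], rule sum_Pow_disjoint_swap[OF finP])
  also have "\<dots> = (\<Sum>A\<in>Pow P. \<Sum>B\<in>Pow P. \<Sum>a\<in>Pow (P - A). \<Sum>a'\<in>Pow (P - B). G a a' A B)"
    by (rule sum.cong[OF refl], rule sum.swap)
  also have "\<dots> = (\<Sum>A\<in>Pow P. \<Sum>B\<in>Pow P. complex_of_real (haf_coeff m (n - k) k (card A) / norm_f m n) *
      per (same x) A B * haf w (P - A) * haf w' (P - B))"
  proof (intro sum.cong refl)
    fix A B assume "A \<in> Pow P" "B \<in> Pow P"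
    then have AB: "A \<subseteq> P" "B \<subseteq> P" by auto
    \<comment> \<open>When \<open>k - \<mu>\<close> is even, \<open>r\<close> is the number of pairs
      in a matching of the complement of \<open>A\<close>.\<close>
    define \<mu> r where "\<mu> = card A" and "r = (k - \<mu>) div 2"
    show "(\<Sum>a\<in>Pow (P - A). \<Sum>a'\<in>Pow (P - B). G a a' A B) =
        complex_of_real (haf_coeff m (n - k) k (card A) / norm_f m n) *
        per (same x) A B * haf w (P - A) * haf w' (P - B)"
    proof (cases "card A = card B")
      case True
      have cA: "card (P - A) = k - \<mu>" "card (P - B) = k - \<mu>" and \<mu>k: "\<mu> \<le> k"
        using AB finP True card_mono[OF finP AB(1)]
        by (auto simp: \<mu>_def cardP card_Diff_subset finite_subset)
      let ?\<psi> = "\<lambda>c. \<Sum>j2\<le>r. of_nat (r choose j2) * \<Phi> \<mu> (c div 2 + j2)"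
      \<comment> \<open>The sum over \<open>a'\<close> is evaluated first, with \<open>s\<close>
        standing for the number of pairs in \<open>a\<close>; the sum over \<open>a\<close> follows
        in the same way.\<close>
      have inner: "(\<Sum>a'\<in>Pow (P - B). \<Phi> \<mu> (s + card a' div 2) * haf w' a' * haf w' (P - B - a')) =
          (\<Sum>j2\<le>r. of_nat (r choose j2) * \<Phi> \<mu> (s + j2)) * haf w' (P - B)" for s
        using haf_split[of "P - B" w' "\<lambda>c. \<Phi> \<mu> (s + c div 2)"] finP w_sym
        by (simp add: cA r_def[symmetric])
      have "(\<Sum>a\<in>Pow (P - A). \<Sum>a'\<in>Pow (P - B). G a a' A B) =
          per (same x) A B * (\<Sum>a\<in>Pow (P - A). (\<Sum>a'\<in>Pow (P - B).
            \<Phi> \<mu> (card a div 2 + card a' div 2) * haf w' a' * haf w' (P - B - a')) *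
            (haf w a * haf w (P - A - a)))"
        by (simp add: G_def \<mu>_def sum_distrib_left sum_distrib_right mult_ac)
      also have "\<dots> = per (same x) A B * haf w' (P - B) *
          (\<Sum>a\<in>Pow (P - A). ?\<psi> (card a) * haf w a * haf w (P - A - a))"
        unfolding inner sum_distrib_left[of _ _ "Pow (P - A)"] by (simp only: mult_ac)
      also have "(\<Sum>a\<in>Pow (P - A). ?\<psi> (card a) * haf w a * haf w (P - A - a)) =
          (\<Sum>j1\<le>r. of_nat (r choose j1) * (\<Sum>j2\<le>r. of_nat (r choose j2) * \<Phi> \<mu> (j1 + j2))) * haf w (P - A)"
        using haf_split[of "P - A" w ?\<psi>] finP w_sym by (simp add: cA r_def[symmetric])
      also have "\<dots> = complex_of_real (haf_coeff m (n - k) k \<mu> / norm_f m n) * haf w (P - A)"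
      \<comment> \<open>For odd \<open>k - \<mu>\<close> both sides are 0, because the Hafnian over
        \<open>P - A\<close> is.\<close>
      proof (cases "even (k - \<mu>)")
        case True
        then have "k = \<mu> + 2 * r" using \<mu>k by (simp add: r_def)
        from F_zbinom_vandermonde[OF assms(5) this assms(3), of m, symmetric]
        show ?thesis by (simp add: \<Phi>_def)
      next
        case False
        then show ?thesis using haf_odd[of "P - A" w] finP cA by simp
      qed
      finally show ?thesis by (simp add: \<mu>_def mult_ac)
    next
      case False
      then show ?thesis by (simp add: G_def per_card_neq)
    qed
  qed
  finally show ?thesis
    unfolding lhs by (rule HOL.sym)
qed

end
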